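(* (In $ZFC$.) $IFS(L)$ holds if and only if every set definable in $L$ is countable.
   Context: $L$ is Gödel's constructible universe. A set $x\in L$ is definable in $L$ if for some formula $\varphi(v)$ without parameters, $L\models\exists!v\,\varphi(v)\wedge\varphi(x)$. For a partial order $P\in L$, $G\subseteq P$ is $L$-generic if $G$ meets every dense subset of $P$ belonging to $L$. $IFS(L)$ is the axiom schema asserting: for every formula $\phi(x)$, if $L\models$ "there is a unique partial order $P$ with $\phi(P)$", then there is an $L$-generic subset of this $P$ in $V$.
   Formalization: An L-generic subset of P is required to be a filter meeting every dense subset of P in L, and partial orders are required to be nonempty; with the literal definition, G = P would always be generic for nonempty P, and the empty order would have no generic subset. *)

theory Defs
  imports Main
begin

text \<open>
  First-order formulas of the language of set theory.  Variables are named by natural numbers.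
\<close>

datatype fm =
    Mem nat nat
  | Equal nat nat
  | Neg fm
  | Conj fm fm
  | All nat fm

primrec fv :: "fm \<Rightarrow> nat set" where
  "fv (Mem i j) = {i, j}"
| "fv (Equal i j) = {i, j}"
| "fv (Neg p) = fv p"
| "fv (Conj p q) = fv p \<union> fv q"
| "fv (All i p) = fv p - {i}"

text \<open>
  The universe of sets is a whole type with an arbitrary binary relation on it; nothing forces the
  relation to be well-founded in the sense of HOL, and its natural numbers may be nonstandard.
  Apart from formula satisfaction, every notion below only quantifies over elements of the
  universe, so it is the interpretation in the structure of a first-order formula.  Notions that
  take a set \<open>N\<close> are relativized to the class \<open>N\<close>.
\<close>

locale set_structure =
  fixes mem :: "'a \<Rightarrow> 'a \<Rightarrow> bool"  (infix "\<^bold>\<in>" 50)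
begin

primrec sat :: "'a set \<Rightarrow> (nat \<Rightarrow> 'a) \<Rightarrow> fm \<Rightarrow> bool" where
  "sat N s (Mem i j) \<longleftrightarrow> s i \<^bold>\<in> s j"
| "sat N s (Equal i j) \<longleftrightarrow> s i = s j"
| "sat N s (Neg p) \<longleftrightarrow> \<not> sat N s p"
| "sat N s (Conj p q) \<longleftrightarrow> sat N s p \<and> sat N s q"
| "sat N s (All i p) \<longleftrightarrow> (\<forall>a\<in>N. sat N (s(i := a)) p)"

definition is_empty :: "'a \<Rightarrow> bool" where
  "is_empty x \<longleftrightarrow> (\<forall>y. \<not> y \<^bold>\<in> x)"

definition subset_of :: "'a \<Rightarrow> 'a \<Rightarrow> bool" where
  "subset_of x y \<longleftrightarrow> (\<forall>z. z \<^bold>\<in> x \<longrightarrow> z \<^bold>\<in> y)"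

definition is_upair :: "'a set \<Rightarrow> 'a \<Rightarrow> 'a \<Rightarrow> 'a \<Rightarrow> bool" where
  "is_upair N a b u \<longleftrightarrow> (\<forall>x\<in>N. x \<^bold>\<in> u \<longleftrightarrow> x = a \<or> x = b)"

definition is_pair :: "'a set \<Rightarrow> 'a \<Rightarrow> 'a \<Rightarrow> 'a \<Rightarrow> bool" where
  "is_pair N a b p \<longleftrightarrow>
     (\<exists>u\<in>N. \<exists>v\<in>N. is_upair N a a u \<and> is_upair N a b v \<and> is_upair N u v p)"

definition related :: "'a set \<Rightarrow> 'a \<Rightarrow> 'a \<Rightarrow> 'a \<Rightarrow> bool" where
  "related N R x y \<longleftrightarrow> (\<exists>p\<in>N. is_pair N x y p \<and> p \<^bold>\<in> R)"

definition function_on :: "'a \<Rightarrow> 'a \<Rightarrow> bool" where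
  "function_on f d \<longleftrightarrow>
     (\<forall>p. p \<^bold>\<in> f \<longrightarrow> (\<exists>x y. x \<^bold>\<in> d \<and> is_pair UNIV x y p)) \<and>
     (\<forall>x. x \<^bold>\<in> d \<longrightarrow> (\<exists>!y. related UNIV f x y))"

definition maps_into :: "'a \<Rightarrow> 'a \<Rightarrow> 'a \<Rightarrow> bool" where
  "maps_into f d c \<longleftrightarrow> function_on f d \<and> (\<forall>x y. related UNIV f x y \<longrightarrow> y \<^bold>\<in> c)"

definition is_succ :: "'a \<Rightarrow> 'a \<Rightarrow> bool" where
  "is_succ x y \<longleftrightarrow> (\<forall>z. z \<^bold>\<in> y \<longleftrightarrow> z \<^bold>\<in> x \<or> z = x)"

definition is_transitive :: "'a \<Rightarrow> bool" where
  "is_transitive x \<longleftrightarrow> (\<forall>y. y \<^bold>\<in> x \<longrightarrow> subset_of y x)"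

definition is_ordinal :: "'a \<Rightarrow> bool" where
  "is_ordinal x \<longleftrightarrow> is_transitive x \<and> (\<forall>y. y \<^bold>\<in> x \<longrightarrow> is_transitive y)"

definition is_limit :: "'a \<Rightarrow> bool" where
  "is_limit x \<longleftrightarrow> is_ordinal x \<and> \<not> is_empty x \<and> \<not> (\<exists>y. is_succ y x)"

definition is_inductive :: "'a \<Rightarrow> bool" where
  "is_inductive w \<longleftrightarrow>
     (\<exists>x. is_empty x \<and> x \<^bold>\<in> w) \<and> (\<forall>x. x \<^bold>\<in> w \<longrightarrow> (\<exists>y. is_succ x y \<and> y \<^bold>\<in> w))"

definition is_omega :: "'a \<Rightarrow> bool" where
  "is_omega w \<longleftrightarrow> is_inductive w \<and> (\<forall>u. is_inductive u \<longrightarrow> subset_of w u)"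

definition is_natural :: "'a \<Rightarrow> bool" where
  "is_natural n \<longleftrightarrow> (\<exists>w. is_omega w \<and> n \<^bold>\<in> w)"

definition is_countable :: "'a \<Rightarrow> bool" where
  "is_countable x \<longleftrightarrow>
     (\<exists>w f. is_omega w \<and> maps_into f x w \<and>
        (\<forall>a b n. related UNIV f a n \<and> related UNIV f b n \<longrightarrow> a = b))"

end

text \<open>
  In the two schemas the values of \<open>s\<close> at the remaining variables are the parameters.
\<close>

locale ZFC = set_structure +
  assumes extensionality: "\<And>x y. (\<forall>z. z \<^bold>\<in> x \<longleftrightarrow> z \<^bold>\<in> y) \<Longrightarrow> x = y"
    and foundation: "\<And>x. \<exists>y. y \<^bold>\<in> x \<Longrightarrow> \<exists>y. y \<^bold>\<in> x \<and> \<not> (\<exists>z. z \<^bold>\<in> x \<and> z \<^bold>\<in> y)"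
    and pairing: "\<And>x y. \<exists>u. \<forall>z. z \<^bold>\<in> u \<longleftrightarrow> z = x \<or> z = y"
    and union: "\<And>x. \<exists>u. \<forall>z. z \<^bold>\<in> u \<longleftrightarrow> (\<exists>y. y \<^bold>\<in> x \<and> z \<^bold>\<in> y)"
    and power_set: "\<And>x. \<exists>u. \<forall>z. z \<^bold>\<in> u \<longleftrightarrow> subset_of z x"
    and infinity: "\<exists>w. is_inductive w"
    and separation: "\<And>p s x. \<exists>u. \<forall>z. z \<^bold>\<in> u \<longleftrightarrow> z \<^bold>\<in> x \<and> sat UNIV (s(0 := z)) p"
    and replacement: "\<And>p s x.
      (\<And>y z z'. y \<^bold>\<in> x \<Longrightarrow> sat UNIV (s(0 := y, 1 := z)) p \<Longrightarrow>
         sat UNIV (s(0 := y, 1 := z')) p \<Longrightarrow> z = z') \<Longrightarrow>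
      \<exists>u. \<forall>z. z \<^bold>\<in> u \<longleftrightarrow> (\<exists>y. y \<^bold>\<in> x \<and> sat UNIV (s(0 := y, 1 := z)) p)"
    and choice: "\<And>x.
      (\<And>y. y \<^bold>\<in> x \<Longrightarrow> \<exists>z. z \<^bold>\<in> y) \<Longrightarrow>
      (\<And>y y' z. y \<^bold>\<in> x \<Longrightarrow> y' \<^bold>\<in> x \<Longrightarrow> z \<^bold>\<in> y \<Longrightarrow> z \<^bold>\<in> y' \<Longrightarrow> y = y') \<Longrightarrow>
      \<exists>c. \<forall>y. y \<^bold>\<in> x \<longrightarrow> (\<exists>!z. z \<^bold>\<in> y \<and> z \<^bold>\<in> c)"

context set_structure
begin

text \<open>
  Definability over a set \<open>A\<close> has to be internal to the structure: the formulas that matter are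
  those coded by the structure's own natural numbers, not the elements of type \<^typ>\<open>fm\<close>.  The
  subsets of \<open>A\<^sup>\<omega>\<close> that are the set of satisfying assignments of some internal formula in
  \<open>(A, \<in>)\<close> are the members of the least family that contains the extensions of \<open>v\<^sub>i \<in> v\<^sub>j\<close> and
  \<open>v\<^sub>i = v\<^sub>j\<close> and is closed under complement, intersection and \<open>\<exists>v\<^sub>i\<close>.
\<close>

definition assignment :: "'a \<Rightarrow> 'a \<Rightarrow> bool" where
  "assignment A s \<longleftrightarrow> (\<exists>w. is_omega w \<and> maps_into s w A)"

definition agree_off :: "'a \<Rightarrow> 'a \<Rightarrow> 'a \<Rightarrow> bool" where
  "agree_off i s t \<longleftrightarrow>
     (\<forall>j a. is_natural j \<and> j \<noteq> i \<longrightarrow> (related UNIV s j a \<longleftrightarrow> related UNIV t j a))"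

definition closed_family :: "'a \<Rightarrow> 'a \<Rightarrow> bool" where
  "closed_family A F \<longleftrightarrow>
     (\<forall>i j R. is_natural i \<and> is_natural j \<and>
        (\<forall>s. s \<^bold>\<in> R \<longleftrightarrow> assignment A s \<and>
           (\<exists>a b. related UNIV s i a \<and> related UNIV s j b \<and> a \<^bold>\<in> b)) \<longrightarrow> R \<^bold>\<in> F) \<and>
     (\<forall>i j R. is_natural i \<and> is_natural j \<and>
        (\<forall>s. s \<^bold>\<in> R \<longleftrightarrow> assignment A s \<and>
           (\<exists>a. related UNIV s i a \<and> related UNIV s j a)) \<longrightarrow> R \<^bold>\<in> F) \<and>
     (\<forall>R S. R \<^bold>\<in> F \<and>
        (\<forall>s. s \<^bold>\<in> S \<longleftrightarrow> assignment A s \<and> \<not> s \<^bold>\<in> R) \<longrightarrow> S \<^bold>\<in> F) \<and>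
     (\<forall>R S T. R \<^bold>\<in> F \<and> S \<^bold>\<in> F \<and>
        (\<forall>s. s \<^bold>\<in> T \<longleftrightarrow> s \<^bold>\<in> R \<and> s \<^bold>\<in> S) \<longrightarrow> T \<^bold>\<in> F) \<and>
     (\<forall>i R S. is_natural i \<and> R \<^bold>\<in> F \<and>
        (\<forall>s. s \<^bold>\<in> S \<longleftrightarrow> assignment A s \<and> (\<exists>t. t \<^bold>\<in> R \<and> agree_off i s t)) \<longrightarrow> S \<^bold>\<in> F)"

definition definable_rel :: "'a \<Rightarrow> 'a \<Rightarrow> bool" where
  "definable_rel A R \<longleftrightarrow> (\<forall>F. closed_family A F \<longrightarrow> R \<^bold>\<in> F)"

text \<open>
  \<open>Def A X\<close>: \<open>X\<close> is definable over \<open>(A, \<in>)\<close> with parameters from \<open>A\<close>.  The parameters are the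
  values of \<open>s\<close> off the variable \<open>v\<^sub>0\<close>.  The empty set is definable over every \<open>A\<close>; it is listed
  separately because there are no assignments into the empty set.
\<close>

definition Def :: "'a \<Rightarrow> 'a \<Rightarrow> bool" where
  "Def A X \<longleftrightarrow> is_empty X \<or>
     (\<exists>R s z. definable_rel A R \<and> assignment A s \<and> is_empty z \<and>
        (\<forall>a. a \<^bold>\<in> X \<longleftrightarrow> a \<^bold>\<in> A \<and> (\<exists>t. t \<^bold>\<in> R \<and> related UNIV t z a \<and> agree_off z s t)))"

text \<open>\<open>L_hierarchy f d\<close>: \<open>f\<close> is the sequence of the \<open>L\<^sub>\<alpha>\<close> for \<open>\<alpha> < d\<close>.\<close>

definition L_hierarchy :: "'a \<Rightarrow> 'a \<Rightarrow> bool" where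
  "L_hierarchy f d \<longleftrightarrow> is_ordinal d \<and> function_on f d \<and>
     (\<forall>\<alpha> A. related UNIV f \<alpha> A \<longrightarrow>
        (is_empty \<alpha> \<longrightarrow> is_empty A) \<and>
        (\<forall>\<beta> B. is_succ \<beta> \<alpha> \<and> related UNIV f \<beta> B \<longrightarrow> (\<forall>X. X \<^bold>\<in> A \<longleftrightarrow> Def B X)) \<and>
        (is_limit \<alpha> \<longrightarrow> (\<forall>x. x \<^bold>\<in> A \<longleftrightarrow> (\<exists>\<beta> B. \<beta> \<^bold>\<in> \<alpha> \<and> related UNIV f \<beta> B \<and> x \<^bold>\<in> B))))"

definition L :: "'a set" where
  "L = {x. \<exists>f d \<alpha> A. L_hierarchy f d \<and> related UNIV f \<alpha> A \<and> x \<^bold>\<in> A}"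

definition definable_in :: "'a set \<Rightarrow> 'a \<Rightarrow> bool" where
  "definable_in N x \<longleftrightarrow> x \<in> N \<and>
     (\<exists>p. fv p \<subseteq> {0} \<and> (\<exists>!v. v \<in> N \<and> sat N (\<lambda>_. v) p) \<and> sat N (\<lambda>_. x) p)"

text \<open>
  A partial order is a pair of a nonempty set and a reflexive, antisymmetric, transitive relation
  on it.  The nonempty requirement is the usual one in forcing; the empty order has no
  generic subset.
\<close>

definition is_partial_order :: "'a set \<Rightarrow> 'a \<Rightarrow> bool" where
  "is_partial_order N P \<longleftrightarrow>
     (\<exists>A\<in>N. \<exists>R\<in>N. is_pair N A R P \<and>
        (\<exists>x\<in>N. x \<^bold>\<in> A) \<and>
        (\<forall>p\<in>N. p \<^bold>\<in> R \<longrightarrow> (\<exists>x\<in>N. \<exists>y\<in>N. x \<^bold>\<in> A \<and> y \<^bold>\<in> A \<and> is_pair N x y p)) \<and>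
        (\<forall>x\<in>N. x \<^bold>\<in> A \<longrightarrow> related N R x x) \<and>
        (\<forall>x\<in>N. \<forall>y\<in>N. related N R x y \<and> related N R y x \<longrightarrow> x = y) \<and>
        (\<forall>x\<in>N. \<forall>y\<in>N. \<forall>z\<in>N. related N R x y \<and> related N R y z \<longrightarrow> related N R x z))"

definition is_dense :: "'a \<Rightarrow> 'a \<Rightarrow> 'a \<Rightarrow> bool" where
  "is_dense A R D \<longleftrightarrow> subset_of D A \<and>
     (\<forall>x. x \<^bold>\<in> A \<longrightarrow> (\<exists>y. y \<^bold>\<in> D \<and> related UNIV R y x))"

definition is_filter :: "'a \<Rightarrow> 'a \<Rightarrow> 'a \<Rightarrow> bool" where
  "is_filter A R G \<longleftrightarrow> subset_of G A \<and> \<not> is_empty G \<and>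
     (\<forall>x y. x \<^bold>\<in> G \<and> y \<^bold>\<in> A \<and> related UNIV R x y \<longrightarrow> y \<^bold>\<in> G) \<and>
     (\<forall>x y. x \<^bold>\<in> G \<and> y \<^bold>\<in> G \<longrightarrow> (\<exists>z. z \<^bold>\<in> G \<and> related UNIV R z x \<and> related UNIV R z y))"

text \<open>
  Generic means generic filter: without the filter condition the whole order would be generic.
\<close>

definition L_generic :: "'a \<Rightarrow> 'a \<Rightarrow> bool" where
  "L_generic P G \<longleftrightarrow>
     (\<exists>A R. is_pair UNIV A R P \<and> is_filter A R G \<and>
        (\<forall>D\<in>L. is_dense A R D \<longrightarrow> (\<exists>x. x \<^bold>\<in> G \<and> x \<^bold>\<in> D)))"

definition IFS_L :: bool where
  "IFS_L \<longleftrightarrow>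
     (\<forall>p. fv p \<subseteq> {0} \<longrightarrow>
        (\<exists>!P. P \<in> L \<and> is_partial_order L P \<and> sat L (\<lambda>_. P) p) \<longrightarrow>
        (\<forall>P\<in>L. is_partial_order L P \<and> sat L (\<lambda>_. P) p \<longrightarrow> (\<exists>G. L_generic P G)))"

end

end

theory Submission
  imports Defs
begin

text \<open>
  The only piece of constructibility theory needed is a comprehension principle: a set of
  constructible sets cut out of \<open>L\<close> by a condition that is absolute between transitive classes is
  constructible, because the condition can be evaluated in a single \<open>L\<^sub>\<alpha>\<close>.

  If \<open>IFS(L)\<close> holds and \<open>x\<close> is definable in \<open>L\<close>, the constructible injective partial functions from
  \<open>x\<close> to natural numbers, ordered by reverse inclusion, form a definable partial order of \<open>L\<close>.  For
  every \<open>y \<in> x\<close> the conditions with \<open>y\<close> in the domain are dense, so the union of an \<open>L\<close>-generic filter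
  is an injection from \<open>x\<close> to \<open>\<omega>\<close>.

  Conversely, if \<open>P\<close> is definable in \<open>L\<close>, so are its domain \<open>A\<close> and the constructible power set of
  \<open>A\<close>.  Both are countable, so a descending sequence that meets all constructible dense sets can be
  built by recursion on \<open>\<omega>\<close>, the enumeration of \<open>A\<close> replacing dependent choice.
\<close>

section \<open>Representable predicates\<close>

text \<open>The universe may be a nonstandard model, so HOL offers no induction along its ordinals
  or its \<open>om\<close>, and a set or an induction is available only for conditions given by a
  formula. The predicate \<open>defn N C Q\<close> carries this obligation: over \<open>N\<close>,
  the HOL predicate \<open>Q\<close> agrees with a formula with parameters from \<open>C\<close>.
  One HOL predicate can be represented over the universe, over \<open>L\<close> and over a level of
  the hierarchy; for bounded predicates this is shown for all transitive classes at once, and this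
  is how absoluteness is expressed. The second obstacle is that \<open>Def\<close> speaks of the
  formulas of the structure itself. The formulas of type \<open>fm\<close> are embedded among them
  through the standard numerals \<open>num n\<close>. The forcing goes from \<open>x\<close> into
  \<open>om\<close>, not from \<open>om\<close> onto \<open>x\<close>, because
  \<open>is_countable\<close> asks for an injection into \<open>om\<close>. This also covers empty
  and finite \<open>x\<close>: the partial functions from \<open>om\<close> to the empty set would
  have no dense sets that make the generic function total.\<close>

lemma finite_fv: "finite (fv p)"
  by (induction p) auto

context set_structure
begin

lemma sat_cong: "(\<And>i. i \<in> fv p \<Longrightarrow> s i = t i) \<Longrightarrow> sat N s p \<longleftrightarrow> sat N t p"
proof (induction p arbitrary: s t)
  case (All i p)
  have "sat N (s(i := a)) p \<longleftrightarrow> sat N (t(i := a)) p" for a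
    by (rule All.IH) (use All.prems in auto)
  then show ?case by simp
next
  case (Neg p)
  have "sat N s p \<longleftrightarrow> sat N t p" by (rule Neg.IH) (use Neg.prems in auto)
  then show ?case by simp
next
  case (Conj p q)
  have "sat N s p \<longleftrightarrow> sat N t p" by (rule Conj.IH) (use Conj.prems in auto)
  moreover have "sat N s q \<longleftrightarrow> sat N t q" by (rule Conj.IH) (use Conj.prems in auto)
  ultimately show ?case by simp
qed auto

text \<open>The induction generalizes over \<open>f\<close>, which may identify variables:
  collapsing all free variables to one later produces formulas with
  \<open>fv p \<subseteq> {0}\<close>.\<close>

lemma rename_fm:
  "\<exists>p'. fv p' \<subseteq> f ` fv p \<and> (\<forall>N s. sat N s p' \<longleftrightarrow> sat N (\<lambda>i. s (f i)) p)"
proof (induction p arbitrary: f)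
  case (Mem i j) show ?case by (rule exI[of _ "Mem (f i) (f j)"]) simp
next
  case (Equal i j) show ?case by (rule exI[of _ "Equal (f i) (f j)"]) simp
next
  case (Neg p)
  then obtain p' where "fv p' \<subseteq> f ` fv p" "\<forall>N s. sat N s p' \<longleftrightarrow> sat N (\<lambda>i. s (f i)) p" by blast
  then show ?case by (intro exI[of _ "Neg p'"]) simp
next
  case (Conj p q)
  obtain p' where p': "fv p' \<subseteq> f ` fv p" "\<forall>N s. sat N s p' \<longleftrightarrow> sat N (\<lambda>i. s (f i)) p"
    using Conj.IH(1) by blast
  obtain q' where q': "fv q' \<subseteq> f ` fv q" "\<forall>N s. sat N s q' \<longleftrightarrow> sat N (\<lambda>i. s (f i)) q"
    using Conj.IH(2) by blast
  from p' q' show ?case by (intro exI[of _ "Conj p' q'"]) auto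
next
  case (All i p)
  \<comment> \<open>The quantified variable is sent to a fresh \<open>m\<close> outside the image of
    all free variables, so it cannot capture a renamed one.\<close>
  obtain m where m: "m \<notin> f ` fv p"
    using ex_new_if_finite[OF infinite_UNIV_nat] finite_fv by (metis finite_imageI)
  obtain p' where p': "fv p' \<subseteq> f(i := m) ` fv p"
      "\<forall>N s. sat N s p' \<longleftrightarrow> sat N (\<lambda>j. s ((f(i := m)) j)) p"
    using All.IH by blast
  have "sat N (\<lambda>j. (s(m := a)) ((f(i := m)) j)) p \<longleftrightarrow> sat N ((\<lambda>j. s (f j))(i := a)) p" for N s a
    by (rule sat_cong) (use m in auto)
  moreover have "fv p' - {m} \<subseteq> f ` (fv p - {i})" using p'(1) m by auto
  ultimately show ?case using p'(2) by (intro exI[of _ "All m p'"]) simp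
qed

text \<open>
  Bound variables are handled in the style of de Bruijn: the rule for a quantifier moves the
  environment up by one, so higher-order unification proves representability of predicates
  written with ordinary HOL connectives.
\<close>

definition tm :: "'a set \<Rightarrow> ((nat \<Rightarrow> 'a) \<Rightarrow> 'a) \<Rightarrow> bool" where
  "tm C t \<longleftrightarrow> (\<exists>i. t = (\<lambda>s. s i)) \<or> (\<exists>a\<in>C. t = (\<lambda>_. a))"

text \<open>Variables of \<open>p\<close> are decoupled from slots of \<open>s\<close>:
  \<open>e\<close> tells which slot or which constant each variable reads. Formulas can then be
  combined by renaming variables alone.\<close>

definition defn :: "'a set \<Rightarrow> 'a set \<Rightarrow> ((nat \<Rightarrow> 'a) \<Rightarrow> bool) \<Rightarrow> bool" where
  "defn N C Q \<longleftrightarrow> (\<exists>p e. (\<forall>i. tm C (e i)) \<and>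
     (\<forall>s. range s \<subseteq> N \<longrightarrow> (Q s \<longleftrightarrow> sat N (\<lambda>i. e i s) p)))"

lemma tm_var: "tm C (\<lambda>s. s i)"
  and tm_const: "a \<in> C \<Longrightarrow> tm C (\<lambda>s. a)"
  by (auto simp: tm_def)

lemma tm_shift: "tm C t \<Longrightarrow> tm C (\<lambda>s. t (\<lambda>i. s (Suc i)))"
  by (auto simp: tm_def)

lemma tm_mono: "tm C t \<Longrightarrow> C \<subseteq> C' \<Longrightarrow> tm C' t"
  by (auto simp: tm_def)

lemma tm_in: "tm C t \<Longrightarrow> C \<subseteq> N \<Longrightarrow> range s \<subseteq> N \<Longrightarrow> t s \<in> N"
  by (auto simp: tm_def)

section \<open>Closure of representability under connectives, quantifiers and substitution\<close>

lemma defnI: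
  assumes "\<And>i. tm C (e i)" "\<And>s. range s \<subseteq> N \<Longrightarrow> Q s \<longleftrightarrow> sat N (\<lambda>i. e i s) p"
  shows "defn N C Q"
  using assms unfolding defn_def by blast

lemma defn_cong: "defn N C Q \<Longrightarrow> (\<And>s. range s \<subseteq> N \<Longrightarrow> Q' s \<longleftrightarrow> Q s) \<Longrightarrow> defn N C Q'"
  unfolding defn_def by meson

lemma defn_mem: "tm C t \<Longrightarrow> tm C u \<Longrightarrow> defn N C (\<lambda>s. t s \<^bold>\<in> u s)"
  by (rule defnI[where e = "\<lambda>i. if i = 0 then t else u" and p = "Mem 0 1"]) auto

lemma defn_eq: "tm C t \<Longrightarrow> tm C u \<Longrightarrow> defn N C (\<lambda>s. t s = u s)"
  by (rule defnI[where e = "\<lambda>i. if i = 0 then t else u" and p = "Equal 0 1"]) auto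

lemma defn_sat: "tm C t \<Longrightarrow> defn N C (\<lambda>s. sat N (\<lambda>_. t s) p)"
  by (rule defnI[where e = "\<lambda>i. t" and p = p]) auto

lemma defn_not: "defn N C Q \<Longrightarrow> defn N C (\<lambda>s. \<not> Q s)"
  unfolding defn_def by (metis sat.simps(3))

lemma defn_and:
  assumes "defn N C Q" "defn N C Q'" shows "defn N C (\<lambda>s. Q s \<and> Q' s)"
proof -
  obtain p e where p: "\<And>i. tm C (e i)"
    "\<And>s. range s \<subseteq> N \<Longrightarrow> Q s \<longleftrightarrow> sat N (\<lambda>i. e i s) p"
    using assms(1) unfolding defn_def by metis
  obtain q e' where q: "\<And>i. tm C (e' i)"
    "\<And>s. range s \<subseteq> N \<Longrightarrow> Q' s \<longleftrightarrow> sat N (\<lambda>i. e' i s) q"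
    using assms(2) unfolding defn_def by metis
  \<comment> \<open>Even variables carry the environment of the first formula and odd ones that of
    the second, so the two do not interfere.\<close>
  obtain p1 where p1: "\<And>s. sat N s p1 \<longleftrightarrow> sat N (\<lambda>i. s (2 * i)) p"
    using rename_fm[of "\<lambda>i. 2 * i" p] by blast
  obtain q1 where q1: "\<And>s. sat N s q1 \<longleftrightarrow> sat N (\<lambda>i. s (Suc (2 * i))) q"
    using rename_fm[of "\<lambda>i. Suc (2 * i)" q] by blast
  show ?thesis
    by (rule defnI[where p = "Conj p1 q1"
          and e = "\<lambda>i. if even i then e (i div 2) else e' (i div 2)"])
       (auto simp: p q p1 q1)
qed

lemma defn_ex_in:
  assumes "defn N C (\<lambda>s. B (\<lambda>i. s (Suc i)) (s 0))"
  shows "defn N C (\<lambda>s. \<exists>a\<in>N. B s a)"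
proof -
  obtain p e where e: "\<And>i. tm C (e i)"
    and p: "\<And>s. range s \<subseteq> N \<Longrightarrow> B (\<lambda>i. s (Suc i)) (s 0) \<longleftrightarrow> sat N (\<lambda>i. e i s) p"
    using assms unfolding defn_def by metis
  \<comment> \<open>Variables that read slot 0, the slot of the bound element, all become the
    quantified variable 0; the others move up by one.\<close>
  define f where "f i = (if e i = (\<lambda>s. s 0) then 0 else Suc i)" for i
  \<comment> \<open>A term other than slot 0 does not see the bound element, so it factors through
    the outer environment.\<close>
  have "\<exists>t. tm C t \<and> (e i \<noteq> (\<lambda>s. s 0) \<longrightarrow> (\<forall>a s. e i (case_nat a s) = t s))" for i
  proof (cases "\<exists>j. e i = (\<lambda>s. s (Suc j))")
    case True
    then obtain j where "e i = (\<lambda>s. s (Suc j))" by blast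
    then show ?thesis by (intro exI[of _ "\<lambda>s. s j"]) (auto simp: tm_def)
  next
    case False
    with e[of i] consider "e i = (\<lambda>s. s 0)" | a where "a \<in> C" "e i = (\<lambda>_. a)"
      unfolding tm_def by (metis not0_implies_Suc)
    then show ?thesis
    proof cases
      case 1 then show ?thesis by (intro exI[of _ "\<lambda>s. s 0"]) (auto simp: tm_def)
    next
      case (2 a) then show ?thesis by (intro exI[of _ "\<lambda>s. a"]) (auto simp: tm_def)
    qed
  qed
  then obtain e0 where e0: "\<And>i. tm C (e0 i)"
    "\<And>i a s. e i \<noteq> (\<lambda>s. s 0) \<Longrightarrow> e i (case_nat a s) = e0 i s" by metis
  \<comment> \<open>Position 0 is a dummy, overwritten by the quantifier.\<close>
  define e' where "e' i = (case i of 0 \<Rightarrow> (\<lambda>s. s 0) | Suc j \<Rightarrow> e0 j)" for i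
  obtain p1 where p1: "\<And>s. sat N s p1 \<longleftrightarrow> sat N (\<lambda>i. s (f i)) p"
    using rename_fm[of f p] by blast
  show ?thesis
  proof (rule defnI[where p = "Neg (All 0 (Neg p1))" and e = e'])
    show "tm C (e' i)" for i using e0 by (auto simp: e'_def tm_var split: nat.split)
    fix s :: "nat \<Rightarrow> 'a" assume s: "range s \<subseteq> N"
    have *: "B s a \<longleftrightarrow> sat N ((\<lambda>i. e' i s)(0 := a)) p1" if "a \<in> N" for a
    proof -
      have "range (case_nat a s) \<subseteq> N" using that s
        by (auto simp: image_subset_iff split: nat.split)
      from p[OF this] have "B s a \<longleftrightarrow> sat N (\<lambda>i. e i (case_nat a s)) p" by simp
      also have "(\<lambda>i. e i (case_nat a s)) = (\<lambda>i. ((\<lambda>i. e' i s)(0 := a)) (f i))"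
      proof
        fix i show "e i (case_nat a s) = ((\<lambda>i. e' i s)(0 := a)) (f i)"
          by (cases "e i = (\<lambda>s. s 0)") (simp_all add: f_def e'_def e0(2))
      qed
      finally show ?thesis by (simp add: p1)
    qed
    have "(\<exists>a\<in>N. B s a) \<longleftrightarrow> (\<exists>a\<in>N. sat N ((\<lambda>i. e' i s)(0 := a)) p1)"
      by (rule bex_cong[OF refl *])
    then show "(\<exists>a\<in>N. B s a) \<longleftrightarrow> sat N (\<lambda>i. e' i s) (Neg (All 0 (Neg p1)))"
      by (simp del: fun_upd_apply)
  qed
qed

lemma defn_or: "defn N C Q \<Longrightarrow> defn N C Q' \<Longrightarrow> defn N C (\<lambda>s. Q s \<or> Q' s)"
  using defn_not[OF defn_and[OF defn_not defn_not]] by simp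

lemma defn_imp: "defn N C Q \<Longrightarrow> defn N C Q' \<Longrightarrow> defn N C (\<lambda>s. Q s \<longrightarrow> Q' s)"
  unfolding imp_conv_disj by (intro defn_or defn_not)

lemma defn_iff: "defn N C Q \<Longrightarrow> defn N C Q' \<Longrightarrow> defn N C (\<lambda>s. Q s \<longleftrightarrow> Q' s)"
  unfolding iff_conv_conj_imp by (intro defn_and defn_imp)

lemma defn_all_in:
  assumes "defn N C (\<lambda>s. B (\<lambda>i. s (Suc i)) (s 0))"
  shows "defn N C (\<lambda>s. \<forall>a\<in>N. B s a)"
  using defn_not[OF defn_ex_in[of N C "\<lambda>s a. \<not> B s a", OF defn_not[OF assms]]] by simp

lemma defn_const: "defn N C (\<lambda>s. P)"
proof (cases P)
  case True
  then show ?thesis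
    using defn_cong[OF defn_eq[OF tm_var tm_var, of N C 0 0], of "\<lambda>_. P"] by simp
next
  case False
  then show ?thesis
    using defn_cong[OF defn_not[OF defn_eq[OF tm_var tm_var, of N C 0 0]], of "\<lambda>_. P"] by simp
qed

lemma defn_mono: "defn N C Q \<Longrightarrow> C \<subseteq> C' \<Longrightarrow> defn N C' Q"
  unfolding defn_def using tm_mono by meson

lemma defn_subst:
  assumes "defn N C Q" "\<And>i. tm C (t i)" "C \<subseteq> N"
  shows "defn N C (\<lambda>s. Q (\<lambda>i. t i s))"
proof -
  obtain p e where e: "\<And>i. tm C (e i)"
    and p: "\<And>s. range s \<subseteq> N \<Longrightarrow> Q s \<longleftrightarrow> sat N (\<lambda>i. e i s) p"
    using assms(1) unfolding defn_def by metis
  have "tm C (\<lambda>s. e i (\<lambda>k. t k s))" for i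
  proof -
    consider j where "e i = (\<lambda>s. s j)" | a where "a \<in> C" "e i = (\<lambda>_. a)"
      using e[of i] unfolding tm_def by blast
    then show ?thesis by cases (use assms(2) in \<open>simp_all add: tm_const\<close>)
  qed
  then show ?thesis
  proof (rule defnI[where p = p])
    fix s :: "nat \<Rightarrow> 'a" assume s: "range s \<subseteq> N"
    have "range (\<lambda>i. t i s) \<subseteq> N" using tm_in[OF assms(2,3) s]
      by (simp add: image_subset_iff)
    from p[OF this] show "Q (\<lambda>i. t i s) \<longleftrightarrow> sat N (\<lambda>i. e i (\<lambda>k. t k s)) p" .
  qed
qed

text \<open>A named predicate has to be represented only once, on plain slots and with no
  parameters; substitution supplies the rule for arbitrary terms. Most rules for named notions below
  are obtained so.\<close>

lemma defn1: "defn N {} (\<lambda>s. Q (s 0)) \<Longrightarrow> tm C t \<Longrightarrow> C \<subseteq> N \<Longrightarrow> defn N C (\<lambda>s. Q (t s))"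
  using defn_subst[OF defn_mono[OF _ empty_subsetI], of N "\<lambda>s. Q (s 0)" C "\<lambda>_. t"] by simp

lemma defn2c: "defn N C (\<lambda>s. Q (s 0) (s 1)) \<Longrightarrow> tm C t \<Longrightarrow> tm C u \<Longrightarrow> C \<subseteq> N \<Longrightarrow>
    defn N C (\<lambda>s. Q (t s) (u s))"
  using defn_subst[of N C "\<lambda>s. Q (s 0) (s 1)" "\<lambda>i. if i = 0 then t else u"] by simp

lemma defn2: "defn N {} (\<lambda>s. Q (s 0) (s 1)) \<Longrightarrow> tm C t \<Longrightarrow> tm C u \<Longrightarrow> C \<subseteq> N \<Longrightarrow>
    defn N C (\<lambda>s. Q (t s) (u s))"
  by (rule defn2c[OF defn_mono[OF _ empty_subsetI]])

lemma defn3: "defn N {} (\<lambda>s. Q (s 0) (s 1) (s 2)) \<Longrightarrow> tm C t \<Longrightarrow> tm C u \<Longrightarrow> tm C v \<Longrightarrow>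
    C \<subseteq> N \<Longrightarrow> defn N C (\<lambda>s. Q (t s) (u s) (v s))"
  using defn_subst[OF defn_mono[OF _ empty_subsetI], of N "\<lambda>s. Q (s 0) (s 1) (s 2)" C
      "\<lambda>i. if i = 0 then t else if i = 1 then u else v"] by simp

section \<open>Transitive classes and bounded quantifiers\<close>

definition trc :: "'a set \<Rightarrow> bool" where
  "trc N \<longleftrightarrow> (\<forall>x\<in>N. \<forall>y. y \<^bold>\<in> x \<longrightarrow> y \<in> N)"

lemma trc_UNIV: "trc UNIV" by (simp add: trc_def)

text \<open>Members of an element of a transitive \<open>N\<close> lie in \<open>N\<close>, so the
  unrestricted HOL quantifier and the one relativized to \<open>N\<close> agree. Every absoluteness
  fact below rests on this.\<close>

lemma defn_ball:
  assumes "tm C t" "defn N C (\<lambda>s. B (\<lambda>i. s (Suc i)) (s 0))" "trc N" "C \<subseteq> N"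
  shows "defn N C (\<lambda>s. \<forall>a. a \<^bold>\<in> t s \<longrightarrow> B s a)"
proof (rule defn_cong)
  show "defn N C (\<lambda>s. \<forall>a\<in>N. a \<^bold>\<in> t s \<longrightarrow> B s a)"
    by (intro defn_all_in defn_imp defn_mem tm_var tm_shift assms)
next
  fix s :: "nat \<Rightarrow> 'a" assume "range s \<subseteq> N"
  then have "t s \<in> N" using tm_in[OF assms(1,4)] by blast
  then show "(\<forall>a. a \<^bold>\<in> t s \<longrightarrow> B s a) \<longleftrightarrow> (\<forall>a\<in>N. a \<^bold>\<in> t s \<longrightarrow> B s a)"
    using assms(3) unfolding trc_def by blast
qed

lemma defn_bex:
  assumes "tm C t" "defn N C (\<lambda>s. B (\<lambda>i. s (Suc i)) (s 0))" "trc N" "C \<subseteq> N"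
  shows "defn N C (\<lambda>s. \<exists>a. a \<^bold>\<in> t s \<and> B s a)"
  using defn_not[OF defn_ball[of C t N "\<lambda>s a. \<not> B s a",
        OF assms(1) defn_not[OF assms(2)] assms(3,4)]] by simp

lemma defn_all: "defn UNIV C (\<lambda>s. B (\<lambda>i. s (Suc i)) (s 0)) \<Longrightarrow> defn UNIV C (\<lambda>s. \<forall>a. B s a)"
  using defn_all_in[of UNIV C B] by simp

lemma defn_ex: "defn UNIV C (\<lambda>s. B (\<lambda>i. s (Suc i)) (s 0)) \<Longrightarrow> defn UNIV C (\<lambda>s. \<exists>a. B s a)"
  using defn_ex_in[of UNIV C B] by simp

lemmas defn_logic = tm_var tm_const defn_eq defn_mem defn_not defn_and defn_or defn_imp defn_iff

lemma defn_ex1: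
  assumes "defn UNIV C (\<lambda>s. B (\<lambda>i. s (Suc i)) (s 0))"
    "defn UNIV C (\<lambda>s. B (\<lambda>i. s (Suc (Suc i))) (s 0))"
  shows "defn UNIV C (\<lambda>s. \<exists>!a. B s a)"
  unfolding Ex1_def by (intro defn_ex defn_all defn_logic assms)

text \<open>With no constants every variable reads a slot. As \<open>Q\<close> sees only slot 0, a
  constant environment may be used, and all free variables collapse to 0.\<close>

lemma defn_closed_formula:
  assumes "defn N {} (\<lambda>s. Q (s 0))"
  shows "\<exists>p. fv p \<subseteq> {0} \<and> (\<forall>v\<in>N. sat N (\<lambda>_. v) p \<longleftrightarrow> Q v)"
proof -
  obtain p e where e: "\<And>i. tm {} (e i)"
    and p: "\<And>s. range s \<subseteq> N \<Longrightarrow> Q (s 0) \<longleftrightarrow> sat N (\<lambda>i. e i s) p"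
    using assms(1) unfolding defn_def by metis
  obtain j where j: "\<And>i. e i = (\<lambda>s. s (j i))" using e unfolding tm_def by (metis empty_iff)
  obtain p1 where p1: "fv p1 \<subseteq> (\<lambda>_. 0) ` fv p" "\<And>s. sat N s p1 \<longleftrightarrow> sat N (\<lambda>i. s 0) p"
    using rename_fm[of "\<lambda>_. 0" p] by blast
  have "sat N (\<lambda>_. v) p1 \<longleftrightarrow> Q v" if "v \<in> N" for v
    using p[of "\<lambda>_. v"] that by (simp add: p1 j image_subset_iff)
  with p1 show ?thesis by blast
qed

lemma defn_formula1:
  assumes "defn N C (\<lambda>s. Q (s 0))" "C \<noteq> {}"
  shows "\<exists>p c. (\<forall>i. c i \<in> C) \<and> (\<forall>v\<in>N. Q v \<longleftrightarrow> sat N (c(0 := v)) p)"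
proof -
  obtain p e where e: "\<And>i. tm C (e i)"
    and p: "\<And>s. range s \<subseteq> N \<Longrightarrow> Q (s 0) \<longleftrightarrow> sat N (\<lambda>i. e i s) p"
    using assms(1) unfolding defn_def by metis
  obtain a0 where a0: "a0 \<in> C" using assms(2) by blast
  have "\<exists>a j. a \<in> C \<and> (e i = (\<lambda>s. s j) \<or> e i = (\<lambda>_. a))" for i
    using e[of i] a0 unfolding tm_def by metis
  then obtain a j where aj: "\<And>i. a i \<in> C" "\<And>i. e i = (\<lambda>s. s (j i)) \<or> e i = (\<lambda>_. a i)" by metis
  \<comment> \<open>Variables that read a slot become variable 0; constants move up by one, and
    \<open>c 0\<close> is a filler that is overwritten.\<close>
  define f where "f i = (if e i = (\<lambda>s. s (j i)) then 0 else Suc i)" for i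
  define c where "c i = (case i of 0 \<Rightarrow> a0 | Suc k \<Rightarrow> a k)" for i
  obtain p1 where p1: "\<And>s. sat N s p1 \<longleftrightarrow> sat N (\<lambda>i. s (f i)) p"
    using rename_fm[of f p] by blast
  have "Q v \<longleftrightarrow> sat N (c(0 := v)) p1" if "v \<in> N" for v
  proof -
    have "Q v \<longleftrightarrow> sat N (\<lambda>i. e i (\<lambda>_. v)) p" using p[of "\<lambda>_. v"] that by (simp add: image_subset_iff)
    also have "(\<lambda>i. e i (\<lambda>_. v)) = (\<lambda>i. (c(0 := v)) (f i))"
    proof
      fix i show "e i (\<lambda>_. v) = (c(0 := v)) (f i)"
        using aj(2)[of i] by (cases "e i = (\<lambda>s. s (j i))") (simp_all add: f_def c_def)
    qed
    finally show ?thesis by (simp add: p1)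
  qed
  moreover have "c i \<in> C" for i using aj a0 by (auto simp: c_def split: nat.split)
  ultimately show ?thesis by blast
qed

lemma defn_formula2:
  assumes "defn UNIV UNIV (\<lambda>s. Q (s 0) (s 1))"
  shows "\<exists>p c. \<forall>v u. Q v u \<longleftrightarrow> sat UNIV (c(0 := v, 1 := u)) p"
proof -
  obtain p e where e: "\<And>i. tm UNIV (e i)"
    and p: "\<And>s. Q (s 0) (s 1) \<longleftrightarrow> sat UNIV (\<lambda>i. e i s) p"
    using assms(1) unfolding defn_def by auto
  have "\<exists>a j. e i = (\<lambda>s. s j) \<or> e i = (\<lambda>_. a)" for i
    using e[of i] unfolding tm_def by metis
  then obtain a j where aj: "\<And>i. e i = (\<lambda>s. s (j i)) \<or> e i = (\<lambda>_. a i)" by metis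
  \<comment> \<open>Slots other than 0 may all be read as \<open>u\<close>, since \<open>Q\<close>
    depends only on slots 0 and 1. Constants start at variable 2, hence the shift in
    \<open>c\<close>.\<close>
  define f where "f i = (if e i = (\<lambda>s. s (j i)) then if j i = 0 then 0 else 1 else Suc (Suc i))" for i
  define c where "c i = (a (i - 2))" for i
  obtain p1 where p1: "\<And>s. sat UNIV s p1 \<longleftrightarrow> sat UNIV (\<lambda>i. s (f i)) p"
    using rename_fm[of f p] by blast
  have "Q v u \<longleftrightarrow> sat UNIV (c(0 := v, 1 := u)) p1" for v u
  proof -
    have "Q v u \<longleftrightarrow> sat UNIV (\<lambda>i. e i (\<lambda>k. if k = 0 then v else u)) p"
      using p[of "\<lambda>k. if k = 0 then v else u"] by simp
    also have "(\<lambda>i. e i (\<lambda>k. if k = 0 then v else u)) = (\<lambda>i. (c(0 := v, 1 := u)) (f i))"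
    proof
      fix i show "e i (\<lambda>k. if k = 0 then v else u) = (c(0 := v, 1 := u)) (f i)"
        using aj[of i] by (cases "e i = (\<lambda>s. s (j i))") (simp_all add: f_def c_def)
    qed
    finally show ?thesis by (simp add: p1)
  qed
  then show ?thesis by blast
qed

section \<open>Absolute predicates, represented in every transitive class by bounded
  formulas\<close>

lemma defn_is_empty: "trc N \<Longrightarrow> tm C t \<Longrightarrow> C \<subseteq> N \<Longrightarrow> defn N C (\<lambda>s. is_empty (t s))"
proof (rule defn1[where Q = is_empty])
  have *: "is_empty x \<longleftrightarrow> (\<forall>y. y \<^bold>\<in> x \<longrightarrow> False)" for x by (simp add: is_empty_def)
  show "defn N {} (\<lambda>s. is_empty (s 0))" if "trc N"
    unfolding * by (intro defn_ball defn_const tm_var that) simp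
qed

lemma defn_subset_of: "trc N \<Longrightarrow> tm C t \<Longrightarrow> tm C u \<Longrightarrow> C \<subseteq> N \<Longrightarrow>
    defn N C (\<lambda>s. subset_of (t s) (u s))"
  by (rule defn2[where Q = subset_of])
     (unfold subset_of_def, intro defn_ball defn_logic, simp_all)

lemma defn_is_succ: "trc N \<Longrightarrow> tm C t \<Longrightarrow> tm C u \<Longrightarrow> C \<subseteq> N \<Longrightarrow>
    defn N C (\<lambda>s. is_succ (t s) (u s))"
proof (rule defn2[where Q = is_succ])
  have *: "is_succ x y \<longleftrightarrow>
      (\<forall>z. z \<^bold>\<in> y \<longrightarrow> z \<^bold>\<in> x \<or> z = x) \<and> (\<forall>z. z \<^bold>\<in> x \<longrightarrow> z \<^bold>\<in> y) \<and> x \<^bold>\<in> y" for x y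
    by (auto simp: is_succ_def)
  show "defn N {} (\<lambda>s. is_succ (s 0) (s 1))" if "trc N"
    unfolding * by (intro defn_ball defn_logic that empty_subsetI)
qed

lemma defn_is_transitive: "trc N \<Longrightarrow> tm C t \<Longrightarrow> C \<subseteq> N \<Longrightarrow> defn N C (\<lambda>s. is_transitive (t s))"
  by (rule defn1[where Q = is_transitive])
     (unfold is_transitive_def, intro defn_ball defn_subset_of defn_logic, simp_all)

lemma defn_is_ordinal: "trc N \<Longrightarrow> tm C t \<Longrightarrow> C \<subseteq> N \<Longrightarrow> defn N C (\<lambda>s. is_ordinal (t s))"
  by (rule defn1[where Q = is_ordinal])
     (unfold is_ordinal_def, intro defn_ball defn_is_transitive defn_logic, simp_all)

lemma defn_is_limit: "trc N \<Longrightarrow> tm C t \<Longrightarrow> C \<subseteq> N \<Longrightarrow> defn N C (\<lambda>s. is_limit (t s))"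
proof (rule defn1[where Q = is_limit])
  \<comment> \<open>A predecessor of \<open>x\<close> is a member of \<open>x\<close>, which bounds
    the quantifier.\<close>
  have *: "is_limit x \<longleftrightarrow> is_ordinal x \<and> \<not> is_empty x \<and> \<not> (\<exists>y. y \<^bold>\<in> x \<and> is_succ y x)" for x
    by (auto simp: is_limit_def is_succ_def)
  show "defn N {} (\<lambda>s. is_limit (s 0))" if "trc N"
    unfolding * by (intro defn_bex defn_is_ordinal defn_is_empty defn_is_succ defn_logic
        that empty_subsetI)
qed

lemma defn_is_pair: "trc N \<Longrightarrow> tm C t \<Longrightarrow> tm C u \<Longrightarrow> tm C v \<Longrightarrow> C \<subseteq> N \<Longrightarrow>
    defn N C (\<lambda>s. is_pair UNIV (t s) (u s) (v s))"
proof (rule defn3[where Q = "is_pair UNIV"])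
  \<comment> \<open>The two witnesses in a Kuratowski pair are members of the pair, so all
    quantifiers can be bounded by \<open>p\<close> and its members.\<close>
  have *: "is_pair UNIV a b p \<longleftrightarrow> (\<exists>u. u \<^bold>\<in> p \<and> (\<exists>v. v \<^bold>\<in> p \<and>
      (\<forall>w. w \<^bold>\<in> p \<longrightarrow> w = u \<or> w = v) \<and> a \<^bold>\<in> u \<and> (\<forall>w. w \<^bold>\<in> u \<longrightarrow> w = a) \<and>
      a \<^bold>\<in> v \<and> b \<^bold>\<in> v \<and> (\<forall>w. w \<^bold>\<in> v \<longrightarrow> w = a \<or> w = b)))" for a b p
  proof -
    have "(\<forall>x. x \<^bold>\<in> u \<longleftrightarrow> x = a \<or> x = a) \<longleftrightarrow> a \<^bold>\<in> u \<and> (\<forall>w. w \<^bold>\<in> u \<longrightarrow> w = a)" for u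
      by blast
    moreover have "(\<forall>x. x \<^bold>\<in> v \<longleftrightarrow> x = a \<or> x = b) \<longleftrightarrow>
        a \<^bold>\<in> v \<and> b \<^bold>\<in> v \<and> (\<forall>w. w \<^bold>\<in> v \<longrightarrow> w = a \<or> w = b)" for a b v
      by blast
    ultimately show ?thesis unfolding is_pair_def is_upair_def by simp blast
  qed
  show "defn N {} (\<lambda>s. is_pair UNIV (s 0) (s 1) (s 2))" if "trc N"
    unfolding * by (intro defn_bex defn_ball defn_logic that empty_subsetI)
qed

lemma defn_related: "trc N \<Longrightarrow> tm C t \<Longrightarrow> tm C u \<Longrightarrow> tm C v \<Longrightarrow> C \<subseteq> N \<Longrightarrow>
    defn N C (\<lambda>s. related UNIV (t s) (u s) (v s))"
proof (rule defn3[where Q = "related UNIV"])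
  have *: "related UNIV R a b \<longleftrightarrow> (\<exists>p. p \<^bold>\<in> R \<and> is_pair UNIV a b p)" for a b R
    unfolding related_def by auto
  show "defn N {} (\<lambda>s. related UNIV (s 0) (s 1) (s 2))" if "trc N"
    unfolding * by (intro defn_bex defn_is_pair defn_logic that empty_subsetI)
qed

lemmas defn_abs = defn_logic defn_ball defn_bex defn_is_empty defn_subset_of defn_is_succ
  defn_is_transitive defn_is_ordinal defn_is_limit defn_is_pair defn_related

lemmas defn_univ = defn_abs defn_all defn_ex defn_ex1 trc_UNIV subset_UNIV UNIV_I

section \<open>Predicates represented over the whole universe only, up to the class
  \<open>L\<close>\<close>

lemma defn_function_on: "tm C t \<Longrightarrow> tm C u \<Longrightarrow> defn UNIV C (\<lambda>s. function_on (t s) (u s))"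
  by (rule defn2[where Q = function_on]) (unfold function_on_def, intro defn_univ, simp_all)

lemma defn_maps_into: "tm C t \<Longrightarrow> tm C u \<Longrightarrow> tm C v \<Longrightarrow>
    defn UNIV C (\<lambda>s. maps_into (t s) (u s) (v s))"
  by (rule defn3[where Q = maps_into])
     (unfold maps_into_def, intro defn_univ defn_function_on, simp_all)

lemma defn_is_inductive: "tm C t \<Longrightarrow> defn UNIV C (\<lambda>s. is_inductive (t s))"
  by (rule defn1[where Q = is_inductive]) (unfold is_inductive_def, intro defn_univ, simp_all)

lemma defn_is_omega: "tm C t \<Longrightarrow> defn UNIV C (\<lambda>s. is_omega (t s))"
  by (rule defn1[where Q = is_omega])
     (unfold is_omega_def, intro defn_univ defn_is_inductive, simp_all)

lemma defn_is_natural: "tm C t \<Longrightarrow> defn UNIV C (\<lambda>s. is_natural (t s))"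
  by (rule defn1[where Q = is_natural])
     (unfold is_natural_def, intro defn_univ defn_is_omega, simp_all)

lemma defn_assignment: "tm C t \<Longrightarrow> tm C u \<Longrightarrow> defn UNIV C (\<lambda>s. assignment (t s) (u s))"
  by (rule defn2[where Q = assignment])
     (unfold assignment_def, intro defn_univ defn_is_omega defn_maps_into, simp_all)

lemma defn_agree_off: "tm C t \<Longrightarrow> tm C u \<Longrightarrow> tm C v \<Longrightarrow>
    defn UNIV C (\<lambda>s. agree_off (t s) (u s) (v s))"
  by (rule defn3[where Q = agree_off])
     (unfold agree_off_def, intro defn_univ defn_is_natural, simp_all)

lemma defn_closed_family: "tm C t \<Longrightarrow> tm C u \<Longrightarrow> defn UNIV C (\<lambda>s. closed_family (t s) (u s))"
  by (rule defn2[where Q = closed_family])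
     (unfold closed_family_def, intro defn_univ defn_is_natural defn_assignment defn_agree_off,
       simp_all)

lemma defn_definable_rel: "tm C t \<Longrightarrow> tm C u \<Longrightarrow> defn UNIV C (\<lambda>s. definable_rel (t s) (u s))"
  by (rule defn2[where Q = definable_rel])
     (unfold definable_rel_def, intro defn_univ defn_closed_family, simp_all)

lemma defn_Def: "tm C t \<Longrightarrow> tm C u \<Longrightarrow> defn UNIV C (\<lambda>s. Def (t s) (u s))"
  by (rule defn2[where Q = Def])
     (unfold Def_def, intro defn_univ defn_definable_rel defn_assignment defn_agree_off, simp_all)

lemma defn_L_hierarchy: "tm C t \<Longrightarrow> tm C u \<Longrightarrow> defn UNIV C (\<lambda>s. L_hierarchy (t s) (u s))"
  by (rule defn2[where Q = L_hierarchy])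
     (unfold L_hierarchy_def, intro defn_univ defn_function_on defn_Def, simp_all)

lemma defn_L: "tm C t \<Longrightarrow> defn UNIV C (\<lambda>s. t s \<in> L)"
  by (rule defn1[where Q = "\<lambda>x. x \<in> L"])
     (unfold L_def mem_Collect_eq, intro defn_univ defn_L_hierarchy, simp_all)

lemmas defn_intros = defn_univ defn_function_on defn_maps_into defn_is_inductive defn_is_omega
  defn_is_natural defn_assignment defn_agree_off defn_closed_family defn_definable_rel defn_Def
  defn_L_hierarchy defn_L

end

section \<open>Sets, ordinals and functions\<close>

context ZFC
begin

lemma sep:
  assumes "defn UNIV UNIV (\<lambda>s. Q (s 0))"
  shows "\<exists>u. \<forall>z. z \<^bold>\<in> u \<longleftrightarrow> z \<^bold>\<in> x \<and> Q z"
proof -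
  obtain p c where "\<And>v. Q v \<longleftrightarrow> sat UNIV (c(0 := v)) p"
    using defn_formula1[OF assms] by auto
  then show ?thesis using separation[of x c p] by simp
qed

lemma repl:
  assumes "defn UNIV UNIV (\<lambda>s. Q (s 0) (s 1))"
    "\<And>y z z'. y \<^bold>\<in> x \<Longrightarrow> Q y z \<Longrightarrow> Q y z' \<Longrightarrow> z = z'"
  shows "\<exists>u. \<forall>z. z \<^bold>\<in> u \<longleftrightarrow> (\<exists>y. y \<^bold>\<in> x \<and> Q y z)"
proof -
  obtain p c where "\<And>v u. Q v u \<longleftrightarrow> sat UNIV (c(0 := v, 1 := u)) p"
    using defn_formula2[OF assms(1)] by metis
  then show ?thesis using replacement[of x c p] assms(2) by simp
qed

lemma ext_iff: "x = y \<longleftrightarrow> (\<forall>z. z \<^bold>\<in> x \<longleftrightarrow> z \<^bold>\<in> y)"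
  using extensionality by blast

lemma the_set:
  assumes "\<exists>u. \<forall>z. z \<^bold>\<in> u \<longleftrightarrow> Q z"
  shows "z \<^bold>\<in> (THE u. \<forall>z. z \<^bold>\<in> u \<longleftrightarrow> Q z) \<longleftrightarrow> Q z"
proof -
  obtain u where u: "\<forall>z. z \<^bold>\<in> u \<longleftrightarrow> Q z" using assms by blast
  have "v = u" if "\<forall>z. z \<^bold>\<in> v \<longleftrightarrow> Q z" for v using u that ext_iff by blast
  with u have "(THE u. \<forall>z. z \<^bold>\<in> u \<longleftrightarrow> Q z) = u" by (rule the_equality)
  then show ?thesis using u by simp
qed

definition upair :: "'a \<Rightarrow> 'a \<Rightarrow> 'a" where
  "upair a b = (THE u. \<forall>z. z \<^bold>\<in> u \<longleftrightarrow> z = a \<or> z = b)"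

lemma mem_upair: "z \<^bold>\<in> upair a b \<longleftrightarrow> z = a \<or> z = b"
  unfolding upair_def by (rule the_set) (rule pairing)

definition pr :: "'a \<Rightarrow> 'a \<Rightarrow> 'a" where
  "pr a b = upair (upair a a) (upair a b)"

lemma is_pair_iff: "is_pair UNIV a b p \<longleftrightarrow> p = pr a b"
proof -
  have "is_upair UNIV a b u \<longleftrightarrow> u = upair a b" for a b u
    by (auto simp: is_upair_def ext_iff[of u] mem_upair)
  then show ?thesis by (simp add: is_pair_def pr_def)
qed

lemma related_iff: "related UNIV R x y \<longleftrightarrow> pr x y \<^bold>\<in> R"
  by (auto simp: related_def is_pair_iff)

lemma pr_inject: "pr a b = pr c d \<longleftrightarrow> a = c \<and> b = d"
proof
  assume "pr a b = pr c d"
  then have *: "z = upair a a \<or> z = upair a b \<longleftrightarrow> z = upair c c \<or> z = upair c d" for z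
    by (metis mem_upair pr_def)
  have "upair x y = upair u v \<longleftrightarrow> (x = u \<and> y = v) \<or> (x = v \<and> y = u)" for x y u v
    unfolding ext_iff[of "upair x y"] mem_upair by metis
  then show "a = c \<and> b = d"
    using *[of "upair a a"] *[of "upair a b"] *[of "upair c c"] *[of "upair c d"] by metis
qed simp

definition emp :: 'a where "emp = (THE x. is_empty x)"

lemma is_empty_iff: "is_empty x \<longleftrightarrow> x = emp"
proof -
  obtain u where "\<forall>z. z \<^bold>\<in> u \<longleftrightarrow> z \<^bold>\<in> x \<and> False"
    using sep[of "\<lambda>_. False"] defn_const by blast
  then have "\<exists>!x. is_empty x" unfolding is_empty_def using extensionality by metis
  then show ?thesis unfolding emp_def by (metis theI')
qed

lemma mem_emp [simp]: "\<not> z \<^bold>\<in> emp"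
  using is_empty_iff is_empty_def by blast

definition un :: "'a \<Rightarrow> 'a \<Rightarrow> 'a" where
  "un a b = (THE u. \<forall>z. z \<^bold>\<in> u \<longleftrightarrow> z \<^bold>\<in> a \<or> z \<^bold>\<in> b)"

lemma mem_un: "z \<^bold>\<in> un a b \<longleftrightarrow> z \<^bold>\<in> a \<or> z \<^bold>\<in> b"
  unfolding un_def
proof (rule the_set)
  obtain u where "\<And>z. z \<^bold>\<in> u \<longleftrightarrow> (\<exists>y. y \<^bold>\<in> upair a b \<and> z \<^bold>\<in> y)" using union by blast
  then show "\<exists>u. \<forall>z. z \<^bold>\<in> u \<longleftrightarrow> z \<^bold>\<in> a \<or> z \<^bold>\<in> b" unfolding mem_upair by blast
qed

definition suc :: "'a \<Rightarrow> 'a" where "suc x = un x (upair x x)"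

lemma mem_suc: "z \<^bold>\<in> suc x \<longleftrightarrow> z \<^bold>\<in> x \<or> z = x"
  by (simp add: suc_def mem_un mem_upair)

lemma is_succ_iff: "is_succ x y \<longleftrightarrow> y = suc x"
  by (simp add: is_succ_def ext_iff[of y] mem_suc)

text \<open>A pair of elements of \<open>x\<close> and \<open>y\<close> lies in the double power set
  of \<open>un x y\<close>, from which separation cuts out the product.\<close>

lemma times_ex: "\<exists>u. \<forall>p. p \<^bold>\<in> u \<longleftrightarrow> (\<exists>a b. a \<^bold>\<in> x \<and> b \<^bold>\<in> y \<and> p = pr a b)"
proof -
  obtain P where P: "\<And>z. z \<^bold>\<in> P \<longleftrightarrow> subset_of z (un x y)" using power_set by metis
  obtain P2 where P2: "\<And>z. z \<^bold>\<in> P2 \<longleftrightarrow> subset_of z P" using power_set by metis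
  have "\<exists>u. \<forall>p. p \<^bold>\<in> u \<longleftrightarrow> p \<^bold>\<in> P2 \<and> (\<exists>a b. a \<^bold>\<in> x \<and> b \<^bold>\<in> y \<and> is_pair UNIV a b p)"
    by (rule sep) (intro defn_intros)
  then obtain u where
    u: "\<And>p. p \<^bold>\<in> u \<longleftrightarrow> p \<^bold>\<in> P2 \<and> (\<exists>a b. a \<^bold>\<in> x \<and> b \<^bold>\<in> y \<and> is_pair UNIV a b p)"
    by blast
  show ?thesis
    by (rule exI[of _ u]) (auto simp: u P P2 subset_of_def is_pair_iff pr_def mem_upair mem_un)
qed

lemma not_mem_self: "\<not> x \<^bold>\<in> x"
  using foundation[of "upair x x"] mem_upair by metis

lemma not_mem_cycle: "x \<^bold>\<in> y \<Longrightarrow> \<not> y \<^bold>\<in> x"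
  using foundation[of "upair x y"] mem_upair by metis

text \<open>Otherwise \<open>x\<close> and \<open>y\<close> would be members of each other.\<close>

lemma suc_inject: "suc x = suc y \<Longrightarrow> x = y"
  by (metis mem_suc not_mem_cycle)

lemma suc_neq_emp: "suc x \<noteq> emp"
  by (metis mem_emp mem_suc)

lemma ordinal_trans: "is_ordinal a \<Longrightarrow> b \<^bold>\<in> a \<Longrightarrow> c \<^bold>\<in> b \<Longrightarrow> c \<^bold>\<in> a"
  unfolding is_ordinal_def is_transitive_def subset_of_def by blast

lemma ordinal_mem: "is_ordinal a \<Longrightarrow> b \<^bold>\<in> a \<Longrightarrow> is_ordinal b"
  unfolding is_ordinal_def is_transitive_def subset_of_def by blast

lemma ordinal_suc: "is_ordinal a \<Longrightarrow> is_ordinal (suc a)"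
  unfolding is_ordinal_def is_transitive_def subset_of_def mem_suc by blast

lemma ordinal_emp: "is_ordinal emp"
  by (simp add: is_ordinal_def is_transitive_def)

text \<open>Foundation is applied to the part of \<open>suc a\<close> where \<open>Q\<close> holds;
  transitivity of \<open>suc a\<close> makes an element that is minimal there minimal among all
  ordinals.\<close>

lemma least_ordinal:
  assumes "defn UNIV UNIV (\<lambda>s. Q (s 0))" "is_ordinal a" "Q a"
  shows "\<exists>b. is_ordinal b \<and> Q b \<and> (\<forall>c. c \<^bold>\<in> b \<longrightarrow> \<not> Q c)"
proof -
  obtain u where u: "\<And>z. z \<^bold>\<in> u \<longleftrightarrow> z \<^bold>\<in> suc a \<and> Q z"
    using sep[OF assms(1)] by metis
  have "a \<^bold>\<in> u" using assms(3) u mem_suc by blast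
  then obtain b where b: "b \<^bold>\<in> u" "\<not> (\<exists>z. z \<^bold>\<in> u \<and> z \<^bold>\<in> b)" using foundation by blast
  have o: "is_ordinal (suc a)" using ordinal_suc[OF assms(2)] .
  have "\<not> Q c" if "c \<^bold>\<in> b" for c using b u ordinal_trans[OF o _ that] that by blast
  then show ?thesis using b(1) u ordinal_mem[OF o] by blast
qed

lemma ordinal_induct:
  assumes "defn UNIV UNIV (\<lambda>s. Q (s 0))" "is_ordinal a"
    "\<And>a. is_ordinal a \<Longrightarrow> (\<And>b. b \<^bold>\<in> a \<Longrightarrow> Q b) \<Longrightarrow> Q a"
  shows "Q a"
  using least_ordinal[OF defn_not[OF assms(1)] assms(2)] assms(3) by blast

text \<open>Induction on \<open>a\<close> with an inner induction on \<open>b\<close>. In the bad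
  case the two hypotheses make each ordinal a subset of the other, contradicting incomparability by
  extensionality.\<close>

lemma ordinal_linear:
  assumes "is_ordinal a" "is_ordinal b"
  shows "a \<^bold>\<in> b \<or> a = b \<or> b \<^bold>\<in> a"
proof -
  have "\<forall>b. is_ordinal b \<longrightarrow> a \<^bold>\<in> b \<or> a = b \<or> b \<^bold>\<in> a"
  proof (rule ordinal_induct[OF _ assms(1)])
    show "defn UNIV UNIV (\<lambda>s. \<forall>b. is_ordinal b \<longrightarrow> s 0 \<^bold>\<in> b \<or> s 0 = b \<or> b \<^bold>\<in> s 0)"
      by (intro defn_intros)
  next
    fix a assume a: "is_ordinal a"
      and IH: "\<And>c. c \<^bold>\<in> a \<Longrightarrow> \<forall>b. is_ordinal b \<longrightarrow> c \<^bold>\<in> b \<or> c = b \<or> b \<^bold>\<in> c"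
    show "\<forall>b. is_ordinal b \<longrightarrow> a \<^bold>\<in> b \<or> a = b \<or> b \<^bold>\<in> a"
    proof (intro allI impI)
      fix b assume "is_ordinal b"
      then show "a \<^bold>\<in> b \<or> a = b \<or> b \<^bold>\<in> a"
      proof (rule ordinal_induct[rotated])
        show "defn UNIV UNIV (\<lambda>s. a \<^bold>\<in> s 0 \<or> a = s 0 \<or> s 0 \<^bold>\<in> a)" by (intro defn_intros)
      next
        fix b assume b: "is_ordinal b" and IHb: "\<And>c. c \<^bold>\<in> b \<Longrightarrow> a \<^bold>\<in> c \<or> a = c \<or> c \<^bold>\<in> a"
        show "a \<^bold>\<in> b \<or> a = b \<or> b \<^bold>\<in> a"
        proof (rule ccontr)
          assume n: "\<not> ?thesis"
          have "c \<^bold>\<in> b" if "c \<^bold>\<in> a" for c using IH[OF that] b n ordinal_trans[OF a that] that by blast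
          moreover have "c \<^bold>\<in> a" if "c \<^bold>\<in> b" for c
            using IHb[OF that] n ordinal_trans[OF b that] that by blast
          ultimately show False using n ext_iff by blast
        qed
      qed
    qed
  qed
  then show ?thesis using assms(2) by blast
qed

text \<open>The union is an ordinal that bounds the members of \<open>x\<close> weakly; its
  successor is taken to bound them strictly.\<close>

lemma ordinal_Union:
  assumes "\<And>y. y \<^bold>\<in> x \<Longrightarrow> is_ordinal y"
  shows "\<exists>d. is_ordinal d \<and> (\<forall>y. y \<^bold>\<in> x \<longrightarrow> y \<^bold>\<in> d)"
proof -
  obtain u where u: "\<And>z. z \<^bold>\<in> u \<longleftrightarrow> (\<exists>y. y \<^bold>\<in> x \<and> z \<^bold>\<in> y)" using union by metis
  have "is_ordinal u"
    using assms unfolding is_ordinal_def is_transitive_def subset_of_def u by blast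
  moreover have "y \<^bold>\<in> suc u" if "y \<^bold>\<in> x" for y
  proof -
    have "\<not> u \<^bold>\<in> y" using that u not_mem_self by blast
    then show ?thesis using ordinal_linear[OF \<open>is_ordinal u\<close> assms[OF that]] mem_suc by blast
  qed
  ultimately show ?thesis using ordinal_suc by blast
qed

definition om :: 'a where "om = (THE w. is_omega w)"

lemma is_inductive_iff: "is_inductive w \<longleftrightarrow> emp \<^bold>\<in> w \<and> (\<forall>x. x \<^bold>\<in> w \<longrightarrow> suc x \<^bold>\<in> w)"
  by (simp add: is_inductive_def is_empty_iff is_succ_iff)

lemma is_omega_iff: "is_omega w \<longleftrightarrow> w = om"
proof -
  obtain w0 where w0: "is_inductive w0" using infinity by blast
  \<comment> \<open>The intersection of all inductive sets, cut out of one of them.\<close>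
  have "\<exists>u. \<forall>z. z \<^bold>\<in> u \<longleftrightarrow> z \<^bold>\<in> w0 \<and> (\<forall>v. is_inductive v \<longrightarrow> z \<^bold>\<in> v)"
    by (rule sep) (intro defn_intros)
  then obtain u where
    u: "\<And>z. z \<^bold>\<in> u \<longleftrightarrow> z \<^bold>\<in> w0 \<and> (\<forall>v. is_inductive v \<longrightarrow> z \<^bold>\<in> v)" by blast
  have "is_inductive u" using w0 by (simp add: is_inductive_iff u)
  then have "is_omega u" unfolding is_omega_def subset_of_def using u by simp
  moreover have "v = u" if "is_omega v" for v
    using that \<open>is_omega u\<close> unfolding is_omega_def subset_of_def ext_iff[of v] by blast
  ultimately have "\<exists>!u. is_omega u" by blast
  then show ?thesis unfolding om_def by (metis theI')
qed

lemma is_natural_iff: "is_natural n \<longleftrightarrow> n \<^bold>\<in> om"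
  by (simp add: is_natural_def is_omega_iff)

lemma emp_om: "emp \<^bold>\<in> om" and suc_om: "n \<^bold>\<in> om \<Longrightarrow> suc n \<^bold>\<in> om"
  using is_omega_iff[of om] unfolding is_omega_def is_inductive_iff by blast+

text \<open>Minimality of \<open>om\<close> among inductive sets gives induction only for conditions
  that separation can form; \<open>om\<close> may have elements that are not values of
  \<open>num\<close>.\<close>

lemma om_induct:
  assumes "defn UNIV UNIV (\<lambda>s. Q (s 0))" "n \<^bold>\<in> om" "Q emp" "\<And>n. n \<^bold>\<in> om \<Longrightarrow> Q n \<Longrightarrow> Q (suc n)"
  shows "Q n"
proof -
  obtain u where u: "\<And>z. z \<^bold>\<in> u \<longleftrightarrow> z \<^bold>\<in> om \<and> Q z" using sep[OF assms(1)] by metis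
  have "is_inductive u" using assms(3,4) emp_om suc_om by (auto simp: is_inductive_iff u)
  then have "subset_of om u" using is_omega_iff[of om] unfolding is_omega_def by blast
  then show ?thesis using assms(2) u unfolding subset_of_def by blast
qed

lemma om_cases: "n \<^bold>\<in> om \<Longrightarrow> n = emp \<or> (\<exists>k. k \<^bold>\<in> om \<and> n = suc k)"
proof (rule om_induct[of "\<lambda>n. n = emp \<or> (\<exists>k. k \<^bold>\<in> om \<and> n = suc k)"])
  show "defn UNIV UNIV (\<lambda>s. s 0 = emp \<or> (\<exists>k. k \<^bold>\<in> om \<and> s 0 = suc k))"
    \<comment> \<open>\<open>suc\<close> applied to a bound variable is not a term in the sense of
      \<open>tm\<close>; the relation \<open>is_succ\<close> is representable.\<close>
    unfolding is_succ_iff[symmetric] by (intro defn_intros)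
qed auto

lemma om_ordinal: "n \<^bold>\<in> om \<Longrightarrow> is_ordinal n"
  by (rule om_induct[of is_ordinal]) (intro defn_intros, simp_all add: ordinal_emp ordinal_suc)

lemma om_mem: "n \<^bold>\<in> om \<Longrightarrow> k \<^bold>\<in> n \<Longrightarrow> k \<^bold>\<in> om"
proof -
  have "n \<^bold>\<in> om \<Longrightarrow> \<forall>k. k \<^bold>\<in> n \<longrightarrow> k \<^bold>\<in> om"
    by (rule om_induct[of "\<lambda>n. \<forall>k. k \<^bold>\<in> n \<longrightarrow> k \<^bold>\<in> om"]) (intro defn_intros, auto simp: mem_suc)
  then show "n \<^bold>\<in> om \<Longrightarrow> k \<^bold>\<in> n \<Longrightarrow> k \<^bold>\<in> om" by blast
qed

lemma ordinal_om: "is_ordinal om"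
proof -
  have "is_transitive n" if "n \<^bold>\<in> om" for n using om_ordinal[OF that] by (simp add: is_ordinal_def)
  then show ?thesis
    using om_mem unfolding is_ordinal_def is_transitive_def[of om] subset_of_def by blast
qed

lemma function_on_iff: "function_on f d \<longleftrightarrow>
    (\<forall>p. p \<^bold>\<in> f \<longrightarrow> (\<exists>x y. x \<^bold>\<in> d \<and> p = pr x y)) \<and> (\<forall>x. x \<^bold>\<in> d \<longrightarrow> (\<exists>!y. pr x y \<^bold>\<in> f))"
  by (simp add: function_on_def is_pair_iff related_iff)

text \<open>A function symbol for HOL reasoning only. Representable conditions on a variable
  argument have to use \<open>related\<close> in its place, as terms are slots or constants.\<close>

definition app :: "'a \<Rightarrow> 'a \<Rightarrow> 'a" where "app f x = (THE y. pr x y \<^bold>\<in> f)"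

lemma mem_function: "function_on f d \<Longrightarrow> pr x y \<^bold>\<in> f \<longleftrightarrow> x \<^bold>\<in> d \<and> y = app f x"
proof -
  assume f: "function_on f d"
  have "x \<^bold>\<in> d" if "pr x y \<^bold>\<in> f" for x y
  proof -
    have "\<exists>x' y'. x' \<^bold>\<in> d \<and> pr x y = pr x' y'"
      using f[unfolded function_on_iff, THEN conjunct1] that by blast
    then show ?thesis unfolding pr_inject by blast
  qed
  moreover have "pr x (app f x) \<^bold>\<in> f" if "x \<^bold>\<in> d" for x
  proof -
    have "\<exists>!y. pr x y \<^bold>\<in> f" using f[unfolded function_on_iff, THEN conjunct2] that by blast
    from theI'[OF this] show ?thesis by (simp add: app_def)
  qed
  moreover have "y = y'" if "pr x y \<^bold>\<in> f" "pr x y' \<^bold>\<in> f" "x \<^bold>\<in> d" for x y y'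
    using f[unfolded function_on_iff, THEN conjunct2] that by blast
  ultimately show "pr x y \<^bold>\<in> f \<longleftrightarrow> x \<^bold>\<in> d \<and> y = app f x" by blast
qed

lemma mem_function':
  assumes f: "function_on f d"
  shows "p \<^bold>\<in> f \<longleftrightarrow> (\<exists>x. x \<^bold>\<in> d \<and> p = pr x (app f x))"
proof
  assume p: "p \<^bold>\<in> f"
  then obtain x y where "p = pr x y" using f[unfolded function_on_iff, THEN conjunct1] by blast
  with p have "x \<^bold>\<in> d" "p = pr x (app f x)" using mem_function[OF f] by auto
  then show "\<exists>x. x \<^bold>\<in> d \<and> p = pr x (app f x)" by blast
qed (use mem_function[OF f] in auto)

lemma function_eqI:
  assumes "function_on f d" "function_on g d" "\<And>x. x \<^bold>\<in> d \<Longrightarrow> app f x = app g x"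
  shows "f = g"
proof -
  have "p \<^bold>\<in> f \<longleftrightarrow> p \<^bold>\<in> g" for p
    unfolding mem_function'[OF assms(1)] mem_function'[OF assms(2)] using assms(3) by auto
  then show ?thesis using ext_iff by blast
qed

text \<open>Replacement is applied to the map from \<open>x\<close> to the pair of \<open>x\<close>
  and its value, so the image is the graph itself.\<close>

lemma function_ex:
  assumes "defn UNIV UNIV (\<lambda>s. Q (s 0) (s 1))" "\<And>x. x \<^bold>\<in> d \<Longrightarrow> \<exists>!y. Q x y"
  shows "\<exists>f. function_on f d \<and> (\<forall>x. x \<^bold>\<in> d \<longrightarrow> Q x (app f x))"
proof -
  have "\<exists>f. \<forall>p. p \<^bold>\<in> f \<longleftrightarrow> (\<exists>x. x \<^bold>\<in> d \<and> (\<exists>y. Q x y \<and> is_pair UNIV x y p))"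
  proof (rule repl)
    show "defn UNIV UNIV (\<lambda>s. \<exists>y. Q (s 0) y \<and> is_pair UNIV (s 0) y (s 1))"
      by (intro defn_intros defn2c[OF assms(1)])
  next
    fix x z z' assume "x \<^bold>\<in> d" "\<exists>y. Q x y \<and> is_pair UNIV x y z" "\<exists>y. Q x y \<and> is_pair UNIV x y z'"
    then show "z = z'" using assms(2)[of x] unfolding is_pair_iff by blast
  qed
  then obtain f where f: "\<And>p. p \<^bold>\<in> f \<longleftrightarrow> (\<exists>x. x \<^bold>\<in> d \<and> (\<exists>y. Q x y \<and> p = pr x y))"
    unfolding is_pair_iff by blast
  have f2: "pr x y \<^bold>\<in> f \<longleftrightarrow> x \<^bold>\<in> d \<and> Q x y" for x y unfolding f pr_inject by blast
  have "function_on f d" unfolding function_on_iff f2 using f assms(2) by blast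
  then show ?thesis using mem_function f2 by blast
qed

section \<open>Restrictions and transfinite recursion\<close>

definition is_restr :: "'a \<Rightarrow> 'a \<Rightarrow> 'a \<Rightarrow> bool" where
  "is_restr f b g \<longleftrightarrow>
     (\<forall>p. p \<^bold>\<in> g \<longleftrightarrow> p \<^bold>\<in> f \<and> (\<exists>x. x \<^bold>\<in> b \<and> (\<exists>y. is_pair UNIV x y p)))"

lemma defn_is_restr: "tm C t \<Longrightarrow> tm C u \<Longrightarrow> tm C v \<Longrightarrow>
    defn UNIV C (\<lambda>s. is_restr (t s) (u s) (v s))"
  by (rule defn3[where Q = is_restr]) (unfold is_restr_def, intro defn_intros, simp_all)

lemma restr_ex: "\<exists>g. is_restr f b g"
  unfolding is_restr_def by (rule sep) (intro defn_intros)

lemma mem_restr: "is_restr f b g \<Longrightarrow> pr x y \<^bold>\<in> g \<longleftrightarrow> x \<^bold>\<in> b \<and> pr x y \<^bold>\<in> f"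
  by (auto simp: is_restr_def is_pair_iff pr_inject)

lemma restr_function:
  assumes f: "function_on f d" and g: "is_restr f b g" and b: "\<And>x. x \<^bold>\<in> b \<Longrightarrow> x \<^bold>\<in> d"
  shows "function_on g b" "x \<^bold>\<in> b \<Longrightarrow> app g x = app f x"
proof -
  have "\<exists>x. x \<^bold>\<in> b \<and> (\<exists>y. p = pr x y)" if "p \<^bold>\<in> g" for p
    using g that unfolding is_restr_def is_pair_iff by blast
  moreover have "\<exists>!y. pr x y \<^bold>\<in> g" if "x \<^bold>\<in> b" for x
    unfolding mem_restr[OF g] mem_function[OF f] using b that by blast
  ultimately show *: "function_on g b" unfolding function_on_iff by blast
  show "app g x = app f x" if "x \<^bold>\<in> b"
    using mem_function[OF *, of x "app g x"] mem_restr[OF g] mem_function[OF f] that by blast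
qed

text \<open>
  The proof recurses along a totalization of \<open>\<Psi>\<close> by a default value, so \<open>\<Psi>\<close> need be functional
  only at the restrictions that occur.
\<close>

lemma transfinite_recursion:
  assumes \<Psi>: "defn UNIV UNIV (\<lambda>s. \<Psi> (s 0) (s 1))" and d: "is_ordinal d"
  shows "\<exists>h. function_on h d \<and>
    (\<forall>b g. b \<^bold>\<in> d \<longrightarrow> is_restr h b g \<longrightarrow> (\<exists>!y. \<Psi> g y) \<longrightarrow> \<Psi> g (app h b))"
proof -
  define \<Phi> where "\<Phi> g y \<longleftrightarrow> \<Psi> g y \<and> (\<exists>!y. \<Psi> g y) \<or> \<not> (\<exists>!y. \<Psi> g y) \<and> y = emp" for g y
  have \<Phi>1: "\<exists>!y. \<Phi> g y" for g
  proof (cases "\<exists>!y. \<Psi> g y")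
    case True
    then have "\<Phi> g y \<longleftrightarrow> \<Psi> g y" for y by (simp add: \<Phi>_def)
    with True show ?thesis by simp
  next
    case False
    then show ?thesis by (simp add: \<Phi>_def)
  qed
  have d\<Phi>: "defn UNIV UNIV (\<lambda>s. \<Phi> (s 0) (s 1))"
    unfolding \<Phi>_def by (intro defn_intros defn2c[OF \<Psi>])
  \<comment> \<open>The partial solutions of length \<open>e\<close>.\<close>
  define approx where "approx f e \<longleftrightarrow> is_ordinal e \<and> function_on f e \<and>
    (\<forall>b g y. b \<^bold>\<in> e \<longrightarrow> is_restr f b g \<longrightarrow> related UNIV f b y \<longrightarrow> \<Phi> g y)" for f e
  have dapprox: "defn UNIV UNIV (\<lambda>s. approx (s 0) (s 1))"
    unfolding approx_def by (intro defn_intros defn_is_restr defn2c[OF d\<Phi>])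
  have approxD: "is_ordinal e" "function_on f e"
    "b \<^bold>\<in> e \<Longrightarrow> is_restr f b g \<Longrightarrow> \<Phi> g (app f b)" if "approx f e" for f e b g
    using that mem_function[of f e b] unfolding approx_def related_iff by blast+
  \<comment> \<open>Restricting first to \<open>b\<close> and then to some \<open>c\<close> in
    \<open>b\<close> is restricting to \<open>c\<close>, so initial segments of a partial solution
    solve the recursion.\<close>
  have approx_restr: "approx g b" if f: "approx f e" and b: "b \<^bold>\<in> e" and g: "is_restr f b g" for f e b g
  proof -
    have *: "x \<^bold>\<in> e" if "x \<^bold>\<in> b" for x using ordinal_trans approxD(1)[OF f] b that by blast
    have ob: "is_ordinal b" using ordinal_mem approxD(1)[OF f] b by blast
    have "\<Phi> k y" if c: "c \<^bold>\<in> b" and k: "is_restr g c k" and y: "pr c y \<^bold>\<in> g" for c k y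
    proof -
      have "x \<^bold>\<in> b" if "x \<^bold>\<in> c" for x using ordinal_trans ob c that by blast
      then have "(\<exists>x. x \<^bold>\<in> b \<and> (\<exists>y. p = pr x y)) \<and> (\<exists>x. x \<^bold>\<in> c \<and> (\<exists>y. p = pr x y)) \<longleftrightarrow>
          (\<exists>x. x \<^bold>\<in> c \<and> (\<exists>y. p = pr x y))" for p by blast
      then have "is_restr f c k" using k g unfolding is_restr_def is_pair_iff by simp
      then have "\<Phi> k (app f c)" using approxD(3)[OF f *[OF c]] by blast
      moreover have "y = app f c"
        using y mem_restr[OF g] mem_function[OF approxD(2)[OF f]] by blast
      ultimately show ?thesis by simp
    qed
    then show ?thesis
      using ob restr_function(1)[OF approxD(2)[OF f] g *] unfolding approx_def related_iff by blast
  qed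
  have uniq: "f = f'" if f: "approx f e" and f': "approx f' e" for f f' e
  proof (rule function_eqI[OF approxD(2)[OF f] approxD(2)[OF f']])
    fix x assume x: "x \<^bold>\<in> e"
    have "x \<^bold>\<in> e \<longrightarrow> (\<forall>y. related UNIV f x y \<longleftrightarrow> related UNIV f' x y)"
    proof (rule ordinal_induct)
      show "is_ordinal x" using x ordinal_mem approxD(1)[OF f] by blast
      show "defn UNIV UNIV (\<lambda>s. s 0 \<^bold>\<in> e \<longrightarrow>
          (\<forall>y. related UNIV f (s 0) y \<longleftrightarrow> related UNIV f' (s 0) y))"
        by (intro defn_intros)
    next
      fix b assume IH: "\<And>c. c \<^bold>\<in> b \<Longrightarrow> c \<^bold>\<in> e \<longrightarrow> (\<forall>y. related UNIV f c y \<longleftrightarrow> related UNIV f' c y)"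
      show "b \<^bold>\<in> e \<longrightarrow> (\<forall>y. related UNIV f b y \<longleftrightarrow> related UNIV f' b y)"
      proof
        assume b: "b \<^bold>\<in> e"
        have sub: "c \<^bold>\<in> e" if "c \<^bold>\<in> b" for c using ordinal_trans approxD(1)[OF f] b that by blast
        obtain g where g: "is_restr f b g" using restr_ex by blast
        obtain g' where g': "is_restr f' b g'" using restr_ex by blast
        have "g = g'"
        proof (rule function_eqI[OF restr_function(1)[OF approxD(2)[OF f] g sub]
              restr_function(1)[OF approxD(2)[OF f'] g' sub]])
          fix c assume c: "c \<^bold>\<in> b"
          have "app f c = app f' c"
            using IH[OF c] sub[OF c] mem_function[OF approxD(2)[OF f]]
              mem_function[OF approxD(2)[OF f']] unfolding related_iff by blast
          then show "app g c = app g' c"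
            using restr_function(2)[OF approxD(2)[OF f] g sub c]
              restr_function(2)[OF approxD(2)[OF f'] g' sub c] by simp
        qed simp_all
        then have "app f b = app f' b"
          using approxD(3)[OF f b g] approxD(3)[OF f' b g'] \<Phi>1[of g] by blast
        then show "\<forall>y. related UNIV f b y \<longleftrightarrow> related UNIV f' b y"
          using mem_function[OF approxD(2)[OF f]] mem_function[OF approxD(2)[OF f']]
          by (simp add: related_iff)
      qed
    qed
    then show "app f x = app f' x"
      using x mem_function[OF approxD(2)[OF f]] mem_function[OF approxD(2)[OF f']]
      unfolding related_iff by blast
  qed
  have "\<exists>f. approx f d"
  proof (rule ordinal_induct[OF _ d])
    show "defn UNIV UNIV (\<lambda>s. \<exists>f. approx f (s 0))" by (intro defn_intros defn2c[OF dapprox])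
  next
    fix e assume e: "is_ordinal e" and IH: "\<And>b. b \<^bold>\<in> e \<Longrightarrow> \<exists>f. approx f b"
    \<comment> \<open>By \<open>uniq\<close> the solution of each smaller length \<open>b\<close> is
      determined, so replacement can collect the values that they prescribe at
      \<open>b\<close>.\<close>
    have "\<exists>f. function_on f e \<and> (\<forall>b. b \<^bold>\<in> e \<longrightarrow> (\<exists>g. approx g b \<and> \<Phi> g (app f b)))"
    proof (rule function_ex)
      show "defn UNIV UNIV (\<lambda>s. \<exists>g. approx g (s 0) \<and> \<Phi> g (s 1))"
        by (intro defn_intros defn2c[OF dapprox] defn2c[OF d\<Phi>])
      fix b assume "b \<^bold>\<in> e"
      then obtain g where g: "approx g b" using IH by blast
      then have "approx g' b \<longleftrightarrow> g' = g" for g' using uniq by blast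
      then show "\<exists>!y. \<exists>g. approx g b \<and> \<Phi> g y" using \<Phi>1[of g] by simp
    qed
    then obtain f where f: "function_on f e"
      and fb: "\<And>b. b \<^bold>\<in> e \<Longrightarrow> \<exists>g. approx g b \<and> \<Phi> g (app f b)" by blast
    have "\<Phi> g y" if b: "b \<^bold>\<in> e" and g: "is_restr f b g" and y: "pr b y \<^bold>\<in> f" for b g y
    proof -
      have sub: "c \<^bold>\<in> e" if "c \<^bold>\<in> b" for c using ordinal_trans e b that by blast
      obtain k where k: "approx k b" "\<Phi> k (app f b)" using fb[OF b] by blast
      \<comment> \<open>At each \<open>c\<close> in \<open>b\<close> the solution of length
        \<open>c\<close> is the restriction of \<open>k\<close>, so \<open>f\<close> and
        \<open>k\<close> take the value that \<open>\<Phi>\<close> assigns to the same set.\<close>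
      have "g = k"
      proof (rule function_eqI[OF restr_function(1)[OF f g sub] approxD(2)[OF k(1)]])
        fix c assume c: "c \<^bold>\<in> b"
        obtain l where l: "approx l c" "\<Phi> l (app f c)" using fb[OF sub[OF c]] by blast
        obtain m where m: "is_restr k c m" using restr_ex by blast
        have "l = m" using uniq[OF l(1) approx_restr[OF k(1) c m]] .
        then have "app f c = app k c" using l(2) approxD(3)[OF k(1) c m] \<Phi>1[of m] by blast
        then show "app g c = app k c" using restr_function(2)[OF f g sub c] by simp
      qed simp_all
      moreover have "y = app f b" using mem_function[OF f] y by blast
      ultimately show ?thesis using k(2) by simp
    qed
    then show "\<exists>f. approx f e" using e f unfolding approx_def related_iff by blast
  qed
  then obtain h where h: "approx h d" by blast
  have "\<Psi> g (app h b)" if "b \<^bold>\<in> d" "is_restr h b g" "\<exists>!y. \<Psi> g y" for b g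
    using approxD(3)[OF h that(1,2)] that(3) unfolding \<Phi>_def by blast
  then show ?thesis using approxD(2)[OF h] by blast
qed

section \<open>Internal definability\<close>

text \<open>The standard numerals: indices of HOL variables inside the structure, by external
  recursion.\<close>

primrec num :: "nat \<Rightarrow> 'a" where
  "num 0 = emp"
| "num (Suc n) = suc (num n)"

lemma num_om: "num n \<^bold>\<in> om"
  by (induction n) (auto simp: emp_om suc_om)

lemma num_inject: "num m = num n \<longleftrightarrow> m = n"
proof (induction m arbitrary: n)
  case 0 then show ?case by (cases n) (auto simp: suc_neq_emp[THEN not_sym])
next
  case (Suc m) then show ?case by (cases n) (auto simp: suc_neq_emp dest: suc_inject)
qed

lemma assignment_iff:
  "assignment A s \<longleftrightarrow> function_on s om \<and> (\<forall>n. n \<^bold>\<in> om \<longrightarrow> app s n \<^bold>\<in> A)"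
  unfolding assignment_def maps_into_def is_omega_iff related_iff
  using mem_function[of s om] by auto

lemma agree_off_iff: "assignment A s \<Longrightarrow> assignment B t \<Longrightarrow>
    agree_off i s t \<longleftrightarrow> (\<forall>j. j \<^bold>\<in> om \<longrightarrow> j \<noteq> i \<longrightarrow> app s j = app t j)"
  unfolding assignment_iff agree_off_def related_iff is_natural_iff
  using mem_function[of s om] mem_function[of t om] by auto

lemma related_assignment: "assignment A s \<Longrightarrow> n \<^bold>\<in> om \<Longrightarrow> related UNIV s n a \<longleftrightarrow> a = app s n"
  unfolding assignment_iff related_iff using mem_function[of s om] by auto

text \<open>Assignments are subsets of the product of \<open>om\<close> and \<open>A\<close>, so
  they form a set.\<close>

lemma assignments_ex:
  assumes "defn UNIV UNIV (\<lambda>s. Q (s 0))"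
  shows "\<exists>u. \<forall>s. s \<^bold>\<in> u \<longleftrightarrow> assignment A s \<and> Q s"
proof -
  obtain P where P: "\<And>p. p \<^bold>\<in> P \<longleftrightarrow> (\<exists>a b. a \<^bold>\<in> om \<and> b \<^bold>\<in> A \<and> p = pr a b)"
    using times_ex by metis
  obtain PP where PP: "\<And>z. z \<^bold>\<in> PP \<longleftrightarrow> subset_of z P" using power_set by metis
  have "\<exists>u. \<forall>s. s \<^bold>\<in> u \<longleftrightarrow> s \<^bold>\<in> PP \<and> (assignment A s \<and> Q s)"
    by (rule sep) (intro defn_intros assms)
  moreover have "s \<^bold>\<in> PP" if "assignment A s" for s
    using that mem_function'[of s om] unfolding PP subset_of_def P assignment_iff by blast
  ultimately show ?thesis by blast
qed

lemma assignment_update: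
  assumes s: "assignment A s" and a: "a \<^bold>\<in> A"
  shows "\<exists>t. assignment A t \<and> (\<forall>j. j \<^bold>\<in> om \<longrightarrow> app t j = (if j = i then a else app s j))"
proof -
  have "\<exists>t. function_on t om \<and>
      (\<forall>j. j \<^bold>\<in> om \<longrightarrow> j = i \<and> app t j = a \<or> j \<noteq> i \<and> related UNIV s j (app t j))"
  proof (rule function_ex)
    fix j assume "j \<^bold>\<in> om"
    then show "\<exists>!y. j = i \<and> y = a \<or> j \<noteq> i \<and> related UNIV s j y"
      using related_assignment[OF s] by auto
  qed (intro defn_intros)
  then obtain t where t: "function_on t om" "\<And>j. j \<^bold>\<in> om \<Longrightarrow>
      j = i \<and> app t j = a \<or> j \<noteq> i \<and> related UNIV s j (app t j)" by blast
  then have *: "app t j = (if j = i then a else app s j)" if "j \<^bold>\<in> om" for j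
    using related_assignment[OF s that] that by force
  then have "assignment A t" using t(1) s a unfolding assignment_iff by simp
  with * show ?thesis by blast
qed

lemma assignment_const: "a \<^bold>\<in> A \<Longrightarrow> \<exists>s. assignment A s"
  using function_ex[of "\<lambda>x y. y = a" om, OF defn_eq] tm_var tm_const
  unfolding assignment_iff by (metis UNIV_I)

text \<open>The external sequence \<open>c\<close> need not be given by any set of the structure.
  Finitely many of its values can be planted in a constant assignment one by one, since distinct
  indices have distinct numerals.\<close>

lemma assignment_finite:
  assumes "finite I" "\<And>i. c i \<^bold>\<in> A"
  shows "\<exists>s. assignment A s \<and> (\<forall>i\<in>I. app s (num i) = c i)"
  using assms(1)
proof induction
  case empty then show ?case using assignment_const[OF assms(2)] by blast
next
  case (insert k I)
  then obtain s where s: "assignment A s" "\<forall>i\<in>I. app s (num i) = c i" by blast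
  obtain t where t: "assignment A t"
    "\<And>j. j \<^bold>\<in> om \<Longrightarrow> app t j = (if j = num k then c k else app s j)"
    using assignment_update[OF s(1) assms(2)] by blast
  then have "\<forall>i\<in>insert k I. app t (num i) = c i"
    using s(2) num_om num_inject by auto
  with t(1) show ?case by blast
qed

section \<open>Formulas of type \<open>fm\<close> define internally definable relations\<close>

lemma closed_family_Mem:
  assumes F: "closed_family A F" and ij: "i \<^bold>\<in> om" "j \<^bold>\<in> om"
    and R: "\<And>s. s \<^bold>\<in> R \<longleftrightarrow> assignment A s \<and> app s i \<^bold>\<in> app s j"
  shows "R \<^bold>\<in> F"
proof -
  have "s \<^bold>\<in> R \<longleftrightarrow> assignment A s \<and> (\<exists>a b. related UNIV s i a \<and> related UNIV s j b \<and> a \<^bold>\<in> b)" for s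
    using R[of s] related_assignment[of A s] ij by auto
  moreover have "\<forall>i j R. is_natural i \<and> is_natural j \<and>
      (\<forall>s. s \<^bold>\<in> R \<longleftrightarrow> assignment A s \<and> (\<exists>a b. related UNIV s i a \<and> related UNIV s j b \<and> a \<^bold>\<in> b)) \<longrightarrow> R \<^bold>\<in> F"
    using F unfolding closed_family_def by (elim conjE)
  ultimately show ?thesis using ij unfolding is_natural_iff by blast
qed

lemma closed_family_Equal:
  assumes F: "closed_family A F" and ij: "i \<^bold>\<in> om" "j \<^bold>\<in> om"
    and R: "\<And>s. s \<^bold>\<in> R \<longleftrightarrow> assignment A s \<and> app s i = app s j"
  shows "R \<^bold>\<in> F"
proof -
  have "s \<^bold>\<in> R \<longleftrightarrow> assignment A s \<and> (\<exists>a. related UNIV s i a \<and> related UNIV s j a)" for s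
    using R[of s] related_assignment[of A s] ij by auto
  moreover have "\<forall>i j R. is_natural i \<and> is_natural j \<and>
      (\<forall>s. s \<^bold>\<in> R \<longleftrightarrow> assignment A s \<and> (\<exists>a. related UNIV s i a \<and> related UNIV s j a)) \<longrightarrow> R \<^bold>\<in> F"
    using F unfolding closed_family_def by (elim conjE)
  ultimately show ?thesis using ij unfolding is_natural_iff by blast
qed

lemma closed_family_Neg: "closed_family A F \<Longrightarrow> R \<^bold>\<in> F \<Longrightarrow>
    (\<And>s. s \<^bold>\<in> S \<longleftrightarrow> assignment A s \<and> \<not> s \<^bold>\<in> R) \<Longrightarrow> S \<^bold>\<in> F"
  unfolding closed_family_def by blast

lemma closed_family_Conj: "closed_family A F \<Longrightarrow> R \<^bold>\<in> F \<Longrightarrow> S \<^bold>\<in> F \<Longrightarrow>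
    (\<And>s. s \<^bold>\<in> T \<longleftrightarrow> s \<^bold>\<in> R \<and> s \<^bold>\<in> S) \<Longrightarrow> T \<^bold>\<in> F"
  unfolding closed_family_def by blast

lemma closed_family_Ex: "closed_family A F \<Longrightarrow> i \<^bold>\<in> om \<Longrightarrow> R \<^bold>\<in> F \<Longrightarrow>
    (\<And>s. s \<^bold>\<in> S \<longleftrightarrow> assignment A s \<and> (\<exists>t. t \<^bold>\<in> R \<and> agree_off i s t)) \<Longrightarrow> S \<^bold>\<in> F"
  unfolding closed_family_def is_natural_iff by blast

text \<open>The induction is external, on \<open>p\<close>: each connective is matched by one
  closure property of a closed family, so the extension lies in every such family.\<close>

lemma definable_rel_sat:
  "\<exists>R. definable_rel A R \<and>
     (\<forall>s. s \<^bold>\<in> R \<longleftrightarrow> assignment A s \<and> sat {x. x \<^bold>\<in> A} (\<lambda>i. app s (num i)) p)"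
proof (induction p)
  case (Mem i j)
  have "\<exists>R. \<forall>s. s \<^bold>\<in> R \<longleftrightarrow> assignment A s \<and>
      (\<exists>a b. related UNIV s (num i) a \<and> related UNIV s (num j) b \<and> a \<^bold>\<in> b)"
    by (rule assignments_ex) (intro defn_intros)
  then obtain R where R: "\<And>s. s \<^bold>\<in> R \<longleftrightarrow> assignment A s \<and> app s (num i) \<^bold>\<in> app s (num j)"
    by (simp add: related_assignment num_om cong: conj_cong) blast
  then have "definable_rel A R"
    unfolding definable_rel_def using closed_family_Mem[OF _ num_om num_om R] by blast
  with R show ?case by (intro exI[of _ R]) simp
next
  case (Equal i j)
  have "\<exists>R. \<forall>s. s \<^bold>\<in> R \<longleftrightarrow> assignment A s \<and>
      (\<exists>a. related UNIV s (num i) a \<and> related UNIV s (num j) a)"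
    by (rule assignments_ex) (intro defn_intros)
  then obtain R where R: "\<And>s. s \<^bold>\<in> R \<longleftrightarrow> assignment A s \<and> app s (num i) = app s (num j)"
    by (simp add: related_assignment num_om cong: conj_cong) blast
  then have "definable_rel A R"
    unfolding definable_rel_def using closed_family_Equal[OF _ num_om num_om R] by blast
  with R show ?case by (intro exI[of _ R]) simp
next
  case (Neg p)
  then obtain R where R: "definable_rel A R"
    "\<And>s. s \<^bold>\<in> R \<longleftrightarrow> assignment A s \<and> sat {x. x \<^bold>\<in> A} (\<lambda>i. app s (num i)) p" by blast
  have "\<exists>S. \<forall>s. s \<^bold>\<in> S \<longleftrightarrow> assignment A s \<and> \<not> s \<^bold>\<in> R"
    by (rule assignments_ex) (intro defn_intros)
  then obtain S where S: "\<And>s. s \<^bold>\<in> S \<longleftrightarrow> assignment A s \<and> \<not> s \<^bold>\<in> R" by blast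
  have "definable_rel A S"
    using R(1) closed_family_Neg[OF _ _ S] unfolding definable_rel_def by blast
  then show ?case using S R(2) by (intro exI[of _ S]) auto
next
  case (Conj p q)
  then obtain R S where R: "definable_rel A R"
    "\<And>s. s \<^bold>\<in> R \<longleftrightarrow> assignment A s \<and> sat {x. x \<^bold>\<in> A} (\<lambda>i. app s (num i)) p"
    and S: "definable_rel A S"
    "\<And>s. s \<^bold>\<in> S \<longleftrightarrow> assignment A s \<and> sat {x. x \<^bold>\<in> A} (\<lambda>i. app s (num i)) q" by blast
  have "\<exists>T. \<forall>s. s \<^bold>\<in> T \<longleftrightarrow> s \<^bold>\<in> R \<and> s \<^bold>\<in> S"
    by (rule sep) (intro defn_intros)
  then obtain T where T: "\<And>s. s \<^bold>\<in> T \<longleftrightarrow> s \<^bold>\<in> R \<and> s \<^bold>\<in> S" by blast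
  have "definable_rel A T"
    using R(1) S(1) closed_family_Conj[OF _ _ _ T] unfolding definable_rel_def by blast
  then show ?case using T R(2) S(2) by (intro exI[of _ T]) auto
next
  case (All i p)
  then obtain R where R: "definable_rel A R"
    "\<And>s. s \<^bold>\<in> R \<longleftrightarrow> assignment A s \<and> sat {x. x \<^bold>\<in> A} (\<lambda>i. app s (num i)) p" by blast
  \<comment> \<open>Closed families provide projections but not universal quantification, so the
    latter is formed as complement, projection, complement.\<close>
  have "\<exists>S. \<forall>s. s \<^bold>\<in> S \<longleftrightarrow> assignment A s \<and> \<not> s \<^bold>\<in> R"
    by (rule assignments_ex) (intro defn_intros)
  then obtain S where S: "\<And>s. s \<^bold>\<in> S \<longleftrightarrow> assignment A s \<and> \<not> s \<^bold>\<in> R" by blast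
  have "\<exists>T. \<forall>s. s \<^bold>\<in> T \<longleftrightarrow> assignment A s \<and> (\<exists>t. t \<^bold>\<in> S \<and> agree_off (num i) s t)"
    by (rule assignments_ex) (intro defn_intros)
  then obtain T where
    T: "\<And>s. s \<^bold>\<in> T \<longleftrightarrow> assignment A s \<and> (\<exists>t. t \<^bold>\<in> S \<and> agree_off (num i) s t)" by blast
  have "\<exists>U. \<forall>s. s \<^bold>\<in> U \<longleftrightarrow> assignment A s \<and> \<not> s \<^bold>\<in> T"
    by (rule assignments_ex) (intro defn_intros)
  then obtain U where U: "\<And>s. s \<^bold>\<in> U \<longleftrightarrow> assignment A s \<and> \<not> s \<^bold>\<in> T" by blast
  have "definable_rel A U"
    unfolding definable_rel_def
  proof (intro allI impI)
    fix F assume F: "closed_family A F"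
    have "R \<^bold>\<in> F" using R(1) F unfolding definable_rel_def by blast
    from closed_family_Neg[OF F this S] have "S \<^bold>\<in> F" .
    from closed_family_Ex[OF F num_om this T] have "T \<^bold>\<in> F" .
    from closed_family_Neg[OF F this U] show "U \<^bold>\<in> F" .
  qed
  moreover have "s \<^bold>\<in> U \<longleftrightarrow> sat {x. x \<^bold>\<in> A} (\<lambda>i. app s (num i)) (All i p)" if s: "assignment A s" for s
  proof -
    \<comment> \<open>On the standard indices, agreeing off \<open>num i\<close> means being an
      update at \<open>i\<close>.\<close>
    have eq: "(\<lambda>k. app t (num k)) = (\<lambda>k. app s (num k))(i := app t (num i))"
      if "assignment A t" "agree_off (num i) s t" for t
      using that agree_off_iff[OF s that(1)] num_om num_inject by (auto simp: fun_eq_iff)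
    have "s \<^bold>\<in> U \<longleftrightarrow> (\<forall>t. assignment A t \<and> agree_off (num i) s t \<longrightarrow>
        sat {x. x \<^bold>\<in> A} (\<lambda>k. app t (num k)) p)"
      unfolding U T S R(2) using s by simp blast
    also have "\<dots> \<longleftrightarrow> (\<forall>a. a \<^bold>\<in> A \<longrightarrow> sat {x. x \<^bold>\<in> A} ((\<lambda>k. app s (num k))(i := a)) p)"
    proof (intro iffI allI impI)
      fix a assume H: "\<forall>t. assignment A t \<and> agree_off (num i) s t \<longrightarrow>
          sat {x. x \<^bold>\<in> A} (\<lambda>k. app t (num k)) p" and a: "a \<^bold>\<in> A"
      obtain t where t: "assignment A t"
        "\<And>j. j \<^bold>\<in> om \<Longrightarrow> app t j = (if j = num i then a else app s j)"
        using assignment_update[OF s a] by blast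
      have "agree_off (num i) s t" using t(2) by (simp add: agree_off_iff[OF s t(1)])
      with H t(1) have "sat {x. x \<^bold>\<in> A} (\<lambda>k. app t (num k)) p" by blast
      then show "sat {x. x \<^bold>\<in> A} ((\<lambda>k. app s (num k))(i := a)) p"
        using eq[OF t(1) \<open>agree_off (num i) s t\<close>] t(2)[OF num_om] by simp
    next
      fix t assume H: "\<forall>a. a \<^bold>\<in> A \<longrightarrow> sat {x. x \<^bold>\<in> A} ((\<lambda>k. app s (num k))(i := a)) p"
        and t: "assignment A t \<and> agree_off (num i) s t"
      have "app t (num i) \<^bold>\<in> A" using t num_om unfolding assignment_iff by blast
      with H show "sat {x. x \<^bold>\<in> A} (\<lambda>k. app t (num k)) p"
        using eq t by simp
    qed
    finally show ?thesis by simp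
  qed
  ultimately show ?case using U by (intro exI[of _ U]) blast
qed

text \<open>The bridge from external to internal definability. The distinguished variable of
  \<open>Def\<close> has index \<open>emp\<close>, which is \<open>num 0\<close>, matching variable
  0 of the formula.\<close>

lemma Def_comprehension:
  assumes "defn {x. x \<^bold>\<in> A} C (\<lambda>s. Q (s 0))" "C \<subseteq> {x. x \<^bold>\<in> A}"
    and X: "\<And>z. z \<^bold>\<in> X \<longleftrightarrow> z \<^bold>\<in> A \<and> Q z"
  shows "Def A X"
proof (cases "is_empty X")
  case False
  \<comment> \<open>An element of \<open>A\<close> is at hand to fill the parameter positions even
    if \<open>C\<close> is empty; an empty \<open>X\<close> is covered by the separate clause of
    \<open>Def\<close>.\<close>
  then obtain z where z: "z \<^bold>\<in> A" using X unfolding is_empty_def by blast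
  obtain p c where c: "\<And>i. c i \<in> insert z C"
    and p: "\<And>v. v \<^bold>\<in> A \<Longrightarrow> Q v \<longleftrightarrow> sat {x. x \<^bold>\<in> A} (c(0 := v)) p"
    using defn_formula1[OF defn_mono[OF assms(1) subset_insertI[of C z]]] by auto
  have cA: "c i \<^bold>\<in> A" for i using c[of i] assms(2) z by blast
  obtain R where R: "definable_rel A R"
    "\<And>s. s \<^bold>\<in> R \<longleftrightarrow> assignment A s \<and> sat {x. x \<^bold>\<in> A} (\<lambda>i. app s (num i)) p"
    using definable_rel_sat by blast
  \<comment> \<open>The parameters matter only at the finitely many free variables of
    \<open>p\<close>.\<close>
  obtain s where s: "assignment A s" "\<And>i. i \<in> fv p \<Longrightarrow> app s (num i) = c i"
    using assignment_finite[of "fv p" c A, OF finite_fv cA] by blast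
  have t: "t \<^bold>\<in> R \<longleftrightarrow> Q a" if t: "assignment A t" "app t emp = a" "agree_off emp s t" for t a
  proof -
    have a: "a \<^bold>\<in> A" using t(1,2) emp_om unfolding assignment_iff by blast
    have "app t (num i) = (c(0 := a)) i" if "i \<in> fv p" for i
    proof (cases i)
      case (Suc k)
      then have "num i \<noteq> emp" by (simp add: suc_neq_emp)
      then show ?thesis using t(3) s(2)[OF that] Suc num_om[of i]
        unfolding agree_off_iff[OF s(1) t(1)] by auto
    qed (use t(2) in simp)
    then have "sat {x. x \<^bold>\<in> A} (\<lambda>i. app t (num i)) p \<longleftrightarrow> sat {x. x \<^bold>\<in> A} (c(0 := a)) p"
      by (rule sat_cong)
    then show ?thesis using R(2) t(1) p[OF a] by simp
  qed
  have "a \<^bold>\<in> X \<longleftrightarrow> a \<^bold>\<in> A \<and> (\<exists>t. t \<^bold>\<in> R \<and> related UNIV t emp a \<and> agree_off emp s t)" for a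
  proof
    assume a: "a \<^bold>\<in> X"
    then have aA: "a \<^bold>\<in> A" using X by blast
    obtain u where u: "assignment A u"
      "\<And>j. j \<^bold>\<in> om \<Longrightarrow> app u j = (if j = emp then a else app s j)"
      using assignment_update[OF s(1) aA] by blast
    have "agree_off emp s u" using u(2) by (simp add: agree_off_iff[OF s(1) u(1)])
    moreover have "app u emp = a" using u(2) emp_om by simp
    ultimately have "u \<^bold>\<in> R" "related UNIV u emp a"
      using t[OF u(1)] a X related_assignment[OF u(1) emp_om] by auto
    then show "a \<^bold>\<in> A \<and> (\<exists>t. t \<^bold>\<in> R \<and> related UNIV t emp a \<and> agree_off emp s t)"
      using aA \<open>agree_off emp s u\<close> by blast
  next
    assume *: "a \<^bold>\<in> A \<and> (\<exists>t. t \<^bold>\<in> R \<and> related UNIV t emp a \<and> agree_off emp s t)"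
    then obtain u where u: "u \<^bold>\<in> R" "related UNIV u emp a" "agree_off emp s u" by blast
    have "assignment A u" using u(1) R(2) by blast
    with u * show "a \<^bold>\<in> X" using t[of u a] related_assignment[of A u emp a] emp_om X by simp
  qed
  then show ?thesis
    unfolding Def_def is_empty_iff using R(1) s(1) by blast
qed (simp add: Def_def)

lemma Def_subset: "Def A X \<Longrightarrow> z \<^bold>\<in> X \<Longrightarrow> z \<^bold>\<in> A"
  unfolding Def_def is_empty_def by blast

lemma Def_set: "\<exists>u. \<forall>X. X \<^bold>\<in> u \<longleftrightarrow> Def A X"
proof -
  obtain P where P: "\<And>z. z \<^bold>\<in> P \<longleftrightarrow> subset_of z A" using power_set by metis
  have "\<exists>u. \<forall>X. X \<^bold>\<in> u \<longleftrightarrow> X \<^bold>\<in> P \<and> Def A X"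
    by (rule sep) (intro defn_intros)
  then show ?thesis using Def_subset unfolding P subset_of_def by blast
qed

section \<open>The constructible hierarchy\<close>

lemma ordinal_cases:
  assumes "is_ordinal a"
  obtains "a = emp" | b where "a = suc b" | "is_limit a"
  using assms unfolding is_limit_def is_empty_iff is_succ_iff by blast

lemma limit_neq: "is_limit a \<Longrightarrow> a \<noteq> emp" "is_limit a \<Longrightarrow> a \<noteq> suc b"
  unfolding is_limit_def is_empty_iff is_succ_iff by blast+

text \<open>The graph of the map from an ordinal \<open>a\<close> to the level
  \<open>L\<^sub>a\<close>, independent of a particular hierarchy sequence.\<close>

definition Lrel :: "'a \<Rightarrow> 'a \<Rightarrow> bool" where
  "Lrel a A \<longleftrightarrow> (\<exists>f d. L_hierarchy f d \<and> related UNIV f a A)"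

lemma defn_Lrel: "tm C t \<Longrightarrow> tm C u \<Longrightarrow> defn UNIV C (\<lambda>s. Lrel (t s) (u s))"
  by (rule defn2[where Q = Lrel]) (unfold Lrel_def, intro defn_intros, simp_all)

lemma L_iff: "x \<in> L \<longleftrightarrow> (\<exists>a A. Lrel a A \<and> x \<^bold>\<in> A)"
  unfolding L_def Lrel_def by blast

lemma hierarchy_dom: "L_hierarchy f d \<Longrightarrow> related UNIV f a A \<longleftrightarrow> a \<^bold>\<in> d \<and> A = app f a"
  unfolding L_hierarchy_def related_iff using mem_function by blast

lemma hierarchy_ord: "L_hierarchy f d \<Longrightarrow> is_ordinal d"
  unfolding L_hierarchy_def by blast

lemma hierarchy_emp: "L_hierarchy f d \<Longrightarrow> related UNIV f emp A \<Longrightarrow> A = emp"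
  unfolding L_hierarchy_def is_empty_iff by blast

lemma hierarchy_suc: "L_hierarchy f d \<Longrightarrow> related UNIV f (suc b) A \<Longrightarrow>
    \<exists>B. related UNIV f b B \<and> (\<forall>X. X \<^bold>\<in> A \<longleftrightarrow> Def B X)"
proof -
  assume f: "L_hierarchy f d" and A: "related UNIV f (suc b) A"
  have "suc b \<^bold>\<in> d" using A hierarchy_dom[OF f] by blast
  then have "b \<^bold>\<in> d" using ordinal_trans[OF hierarchy_ord[OF f]] mem_suc by blast
  then have B: "related UNIV f b (app f b)" using hierarchy_dom[OF f] by blast
  have "\<forall>\<beta> B. is_succ \<beta> (suc b) \<and> related UNIV f \<beta> B \<longrightarrow> (\<forall>X. X \<^bold>\<in> A \<longleftrightarrow> Def B X)"
    using f A unfolding L_hierarchy_def by blast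
  with B show ?thesis unfolding is_succ_iff by blast
qed

lemma hierarchy_limit: "L_hierarchy f d \<Longrightarrow> related UNIV f a A \<Longrightarrow> is_limit a \<Longrightarrow>
    x \<^bold>\<in> A \<longleftrightarrow> (\<exists>b. b \<^bold>\<in> a \<and> x \<^bold>\<in> app f b)"
proof -
  assume f: "L_hierarchy f d" and A: "related UNIV f a A" and a: "is_limit a"
  have d: "a \<^bold>\<in> d" using A hierarchy_dom[OF f] by blast
  have "x \<^bold>\<in> A \<longleftrightarrow> (\<exists>b B. b \<^bold>\<in> a \<and> related UNIV f b B \<and> x \<^bold>\<in> B)"
    using f A a unfolding L_hierarchy_def by blast
  also have "\<dots> \<longleftrightarrow> (\<exists>b. b \<^bold>\<in> a \<and> x \<^bold>\<in> app f b)"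
    unfolding hierarchy_dom[OF f] using ordinal_trans[OF hierarchy_ord[OF f] d] by blast
  finally show ?thesis .
qed

text \<open>Hierarchies of different lengths agree wherever both are defined, by induction on the
  index through the zero, successor and limit clauses.\<close>

lemma Lrel_unique: "Lrel a A \<Longrightarrow> Lrel a A' \<Longrightarrow> A = A'"
proof -
  assume A: "Lrel a A" "Lrel a A'"
  have "is_ordinal a"
    using A(1) hierarchy_dom hierarchy_ord ordinal_mem unfolding Lrel_def by blast
  then have "\<forall>A A'. Lrel a A \<longrightarrow> Lrel a A' \<longrightarrow> A = A'"
  proof (rule ordinal_induct[rotated])
    show "defn UNIV UNIV (\<lambda>s. \<forall>A A'. Lrel (s 0) A \<longrightarrow> Lrel (s 0) A' \<longrightarrow> A = A')"
      by (intro defn_intros defn_Lrel)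
  next
    fix a assume a: "is_ordinal a"
      and IH: "\<And>b. b \<^bold>\<in> a \<Longrightarrow> \<forall>A A'. Lrel b A \<longrightarrow> Lrel b A' \<longrightarrow> A = A'"
    show "\<forall>A A'. Lrel a A \<longrightarrow> Lrel a A' \<longrightarrow> A = A'"
    proof (intro allI impI)
      fix A A' assume "Lrel a A" "Lrel a A'"
      then obtain f d f' d' where f: "L_hierarchy f d" "related UNIV f a A"
        and f': "L_hierarchy f' d'" "related UNIV f' a A'" unfolding Lrel_def by blast
      from a show "A = A'"
      proof (cases rule: ordinal_cases)
        case 1
        then show ?thesis using hierarchy_emp f f' by metis
      next
        case (2 b)
        obtain B where B: "related UNIV f b B" "\<And>X. X \<^bold>\<in> A \<longleftrightarrow> Def B X"
          using hierarchy_suc f 2 by blast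
        obtain B' where B': "related UNIV f' b B'" "\<And>X. X \<^bold>\<in> A' \<longleftrightarrow> Def B' X"
          using hierarchy_suc f' 2 by blast
        have "b \<^bold>\<in> a" using 2 mem_suc by blast
        then have "B = B'" using IH B(1) B'(1) f(1) f'(1) unfolding Lrel_def by blast
        then show ?thesis unfolding ext_iff[of A] B(2) B'(2) by simp
      next
        case 3
        have "app f b = app f' b" if b: "b \<^bold>\<in> a" for b
        proof -
          have "b \<^bold>\<in> d" "b \<^bold>\<in> d'"
            using f f' hierarchy_dom ordinal_trans[OF hierarchy_ord] b by blast+
          then have "Lrel b (app f b)" "Lrel b (app f' b)"
            unfolding Lrel_def using f(1) f'(1) hierarchy_dom by blast+
          then show ?thesis using IH[OF b] by blast
        qed
        then show ?thesis
          unfolding ext_iff[of A] hierarchy_limit[OF f 3] hierarchy_limit[OF f' 3] by auto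
      qed
    qed
  qed
  with A show ?thesis by blast
qed

lemma Lrel_ordinal: "Lrel a A \<Longrightarrow> is_ordinal a"
  using hierarchy_dom hierarchy_ord ordinal_mem unfolding Lrel_def by blast

lemma Lrel_ex: assumes a: "is_ordinal a" shows "\<exists>A. Lrel a A"
proof -
  define St where "St R d y \<longleftrightarrow>
     (is_empty d \<longrightarrow> is_empty y) \<and>
     (\<forall>\<beta> B. is_succ \<beta> d \<and> related UNIV R \<beta> B \<longrightarrow> (\<forall>X. X \<^bold>\<in> y \<longleftrightarrow> Def B X)) \<and>
     (is_limit d \<longrightarrow> (\<forall>x. x \<^bold>\<in> y \<longleftrightarrow> (\<exists>\<beta> B. \<beta> \<^bold>\<in> d \<and> related UNIV R \<beta> B \<and> x \<^bold>\<in> B)))" for R d y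
  \<comment> \<open>The recursion step receives only the restriction \<open>g\<close>, so the
    current index is recovered as the domain of \<open>g\<close>.\<close>
  define \<Psi> where "\<Psi> g y \<longleftrightarrow> (\<exists>d. (\<forall>k. k \<^bold>\<in> d \<longleftrightarrow> (\<exists>q. related UNIV g k q)) \<and> St g d y)" for g y
  have "defn UNIV UNIV (\<lambda>s. \<Psi> (s 0) (s 1))"
    unfolding \<Psi>_def St_def by (intro defn_intros)
  \<comment> \<open>The recursion has length \<open>suc a\<close> in order to have a value at
    \<open>a\<close>.\<close>
  from transfinite_recursion[OF this ordinal_suc[OF a]]
  obtain h where h: "function_on h (suc a)"
    and \<Psi>: "\<And>b g. b \<^bold>\<in> suc a \<Longrightarrow> is_restr h b g \<Longrightarrow> \<exists>!y. \<Psi> g y \<Longrightarrow> \<Psi> g (app h b)" by blast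
  have St: "St h b (app h b)" if b: "b \<^bold>\<in> suc a" for b
  proof -
    have ob: "is_ordinal b" using ordinal_mem ordinal_suc[OF a] b by blast
    have sub: "c \<^bold>\<in> suc a" if "c \<^bold>\<in> b" for c using ordinal_trans ordinal_suc[OF a] b that by blast
    obtain g where g: "is_restr h b g" using restr_ex by blast
    have dom: "k \<^bold>\<in> b \<longleftrightarrow> (\<exists>q. related UNIV g k q)" for k
      unfolding related_iff mem_restr[OF g] mem_function[OF h] using sub by blast
    have "d = b" if "\<forall>k. k \<^bold>\<in> d \<longleftrightarrow> (\<exists>q. related UNIV g k q)" for d
      using that unfolding ext_iff[of d] dom by blast
    then have \<Psi>g: "\<Psi> g y \<longleftrightarrow> St g b y" for y unfolding \<Psi>_def using dom by blast
    \<comment> \<open>\<open>St\<close> consults the sequence only below \<open>b\<close>, where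
      \<open>g\<close> and \<open>h\<close> agree.\<close>
    have "c \<^bold>\<in> b \<longrightarrow> related UNIV g c B = related UNIV h c B" for c B
      unfolding related_iff mem_restr[OF g] by blast
    moreover have "is_succ c b \<longrightarrow> c \<^bold>\<in> b" for c by (simp add: is_succ_def)
    ultimately have Sth: "St g b y \<longleftrightarrow> St h b y" for y
      unfolding St_def by (simp cong: conj_cong)
    have "\<exists>!y. St h b y"
      using ob
    proof (cases rule: ordinal_cases)
      case 1
      then have "St h b y \<longleftrightarrow> y = emp" for y
        using suc_neq_emp limit_neq(1)
        unfolding St_def is_empty_iff is_succ_iff by metis
      then show ?thesis by simp
    next
      case (2 c)
      have c: "related UNIV h c B \<longleftrightarrow> B = app h c" for B
        unfolding related_iff mem_function[OF h] using sub 2 mem_suc by blast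
      have cs: "is_succ x b \<longleftrightarrow> x = c" for x using 2 suc_inject unfolding is_succ_iff by blast
      have "St h b y \<longleftrightarrow> (\<forall>X. X \<^bold>\<in> y \<longleftrightarrow> Def (app h c) X)" for y
        unfolding St_def cs is_empty_iff using 2 suc_neq_emp limit_neq(2) c by metis
      then show ?thesis using Def_set[of "app h c"] extensionality by metis
    next
      case 3
      have "St h b y \<longleftrightarrow> (\<forall>x. x \<^bold>\<in> y \<longleftrightarrow> (\<exists>\<beta> B. \<beta> \<^bold>\<in> b \<and> related UNIV h \<beta> B \<and> x \<^bold>\<in> B))" for y
        unfolding St_def is_empty_iff is_succ_iff using 3 limit_neq by blast
      moreover have "\<exists>y. \<forall>x. x \<^bold>\<in> y \<longleftrightarrow> (\<exists>\<beta> B. \<beta> \<^bold>\<in> b \<and> related UNIV h \<beta> B \<and> x \<^bold>\<in> B)"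
      proof -
        have "\<exists>v. \<forall>B. B \<^bold>\<in> v \<longleftrightarrow> (\<exists>\<beta>. \<beta> \<^bold>\<in> b \<and> related UNIV h \<beta> B)"
        proof (rule repl)
          show "defn UNIV UNIV (\<lambda>s. related UNIV h (s 0) (s 1))" by (intro defn_intros)
        qed (use mem_function[OF h] in \<open>auto simp: related_iff\<close>)
        then obtain v where v: "\<And>B. B \<^bold>\<in> v \<longleftrightarrow> (\<exists>\<beta>. \<beta> \<^bold>\<in> b \<and> related UNIV h \<beta> B)" by blast
        obtain y where "\<And>x. x \<^bold>\<in> y \<longleftrightarrow> (\<exists>B. B \<^bold>\<in> v \<and> x \<^bold>\<in> B)" using union by metis
        then show ?thesis unfolding v by blast
      qed
      ultimately show ?thesis using extensionality by metis
    qed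
    then have "\<exists>!y. \<Psi> g y" unfolding \<Psi>g Sth .
    from \<Psi>[OF b g this] show ?thesis unfolding \<Psi>g Sth .
  qed
  have "L_hierarchy h (suc a)"
    unfolding L_hierarchy_def
  proof (intro conjI allI impI)
    fix b B assume "related UNIV h b B"
    then have "b \<^bold>\<in> suc a" "B = app h b" unfolding related_iff mem_function[OF h] by auto
    then have "St h b B" using St by simp
    then show "is_empty b \<Longrightarrow> is_empty B"
      "is_limit b \<Longrightarrow> x \<^bold>\<in> B \<longleftrightarrow> (\<exists>\<beta> C. \<beta> \<^bold>\<in> b \<and> related UNIV h \<beta> C \<and> x \<^bold>\<in> C)"
      "is_succ c b \<and> related UNIV h c C \<Longrightarrow> X \<^bold>\<in> B \<longleftrightarrow> Def C X" for x c C X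
      unfolding St_def by blast+
  qed (use h ordinal_suc[OF a] in simp_all)
  moreover have "related UNIV h a (app h a)"
    unfolding related_iff mem_function[OF h] by (simp add: mem_suc)
  ultimately show ?thesis unfolding Lrel_def by blast
qed

lemma Lrel_emp: "Lrel emp A \<Longrightarrow> A = emp"
  unfolding Lrel_def using hierarchy_emp by blast

lemma Lrel_suc: "Lrel (suc b) A \<Longrightarrow> Lrel b B \<Longrightarrow> X \<^bold>\<in> A \<longleftrightarrow> Def B X"
proof -
  assume "Lrel (suc b) A" "Lrel b B"
  then obtain f d where f: "L_hierarchy f d" "related UNIV f (suc b) A" unfolding Lrel_def by blast
  then obtain B' where B': "related UNIV f b B'" "\<forall>X. X \<^bold>\<in> A \<longleftrightarrow> Def B' X"
    using hierarchy_suc by blast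
  then have "B' = B" using Lrel_unique \<open>Lrel b B\<close> f(1) unfolding Lrel_def by blast
  with B' show ?thesis by blast
qed

lemma Lrel_limit:
  assumes "Lrel a A" "is_limit a"
  shows "x \<^bold>\<in> A \<longleftrightarrow> (\<exists>b B. b \<^bold>\<in> a \<and> Lrel b B \<and> x \<^bold>\<in> B)"
proof -
  obtain f d where f: "L_hierarchy f d" "related UNIV f a A"
    using assms(1) unfolding Lrel_def by blast
  have "Lrel b B \<longleftrightarrow> B = app f b" if "b \<^bold>\<in> a" for b B
  proof -
    have "b \<^bold>\<in> d" using f hierarchy_dom ordinal_trans[OF hierarchy_ord] that by blast
    then have "Lrel b (app f b)" unfolding Lrel_def using f(1) hierarchy_dom by blast
    then show ?thesis using Lrel_unique by blast
  qed
  then show ?thesis unfolding hierarchy_limit[OF f assms(2)] by (simp cong: conj_cong)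
qed

text \<open>One induction serves both claims, because at a successor it is transitivity of the lower
  level that puts it inside the next one.\<close>

lemma Lrel_mono_trans:
  assumes "Lrel b B"
  shows "is_transitive B" "\<And>a A. a \<^bold>\<in> b \<Longrightarrow> Lrel a A \<Longrightarrow> subset_of A B"
proof -
  have "\<forall>B. Lrel b B \<longrightarrow>
      is_transitive B \<and> (\<forall>a A. a \<^bold>\<in> b \<longrightarrow> Lrel a A \<longrightarrow> subset_of A B)"
  proof (rule ordinal_induct[OF _ Lrel_ordinal[OF assms]])
    show "defn UNIV UNIV (\<lambda>s. \<forall>B. Lrel (s 0) B \<longrightarrow>
      is_transitive B \<and> (\<forall>a A. a \<^bold>\<in> s 0 \<longrightarrow> Lrel a A \<longrightarrow> subset_of A B))"
      by (intro defn_intros defn_Lrel)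
  next
    fix b assume b: "is_ordinal b" and IH: "\<And>c. c \<^bold>\<in> b \<Longrightarrow> \<forall>B. Lrel c B \<longrightarrow>
      is_transitive B \<and> (\<forall>a A. a \<^bold>\<in> c \<longrightarrow> Lrel a A \<longrightarrow> subset_of A B)"
    show "\<forall>B. Lrel b B \<longrightarrow>
      is_transitive B \<and> (\<forall>a A. a \<^bold>\<in> b \<longrightarrow> Lrel a A \<longrightarrow> subset_of A B)"
    proof (intro allI impI)
      fix B assume B: "Lrel b B"
      from b show "is_transitive B \<and> (\<forall>a A. a \<^bold>\<in> b \<longrightarrow> Lrel a A \<longrightarrow> subset_of A B)"
      proof (cases rule: ordinal_cases)
        case 1
        then show ?thesis using Lrel_emp[of B] B by (simp add: is_transitive_def)
      next
        case (2 c)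
        then have c: "c \<^bold>\<in> b" using mem_suc by blast
        obtain D where D: "Lrel c D" using Lrel_ex[OF ordinal_mem[OF b c]] by blast
        have BD: "X \<^bold>\<in> B \<longleftrightarrow> Def D X" for X using Lrel_suc B D 2 by blast
        have tD: "z \<^bold>\<in> D" if "z \<^bold>\<in> x" "x \<^bold>\<in> D" for x z
          using IH[OF c] D that unfolding is_transitive_def subset_of_def by blast
        \<comment> \<open>By transitivity of \<open>D\<close>, the set \<open>x\<close> is the part
          of \<open>D\<close> defined by membership in the parameter \<open>x\<close>.\<close>
        have DB: "x \<^bold>\<in> B" if x: "x \<^bold>\<in> D" for x
          unfolding BD
        proof (rule Def_comprehension)
          show "defn {x. x \<^bold>\<in> D} {x} (\<lambda>s. s 0 \<^bold>\<in> x)" by (intro defn_logic) simp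
        qed (use tD x in auto)
        have "is_transitive B"
          unfolding is_transitive_def subset_of_def using BD Def_subset DB by blast
        moreover have "subset_of A B" if "a \<^bold>\<in> b" "Lrel a A" for a A
        proof -
          have "a \<^bold>\<in> c \<or> a = c" using that(1) 2 mem_suc by blast
          then have "subset_of A D"
            using IH[OF c] D that(2) Lrel_unique[OF D] unfolding subset_of_def by blast
          then show ?thesis using DB unfolding subset_of_def by blast
        qed
        ultimately show ?thesis by blast
      next
        case 3
        note B3 = Lrel_limit[OF B 3]
        have "is_transitive B"
          unfolding is_transitive_def subset_of_def
        proof (intro allI impI)
          fix x z assume "x \<^bold>\<in> B" "z \<^bold>\<in> x"
          then obtain c D where c: "c \<^bold>\<in> b" "Lrel c D" "x \<^bold>\<in> D" using B3 by blast
          then have "is_transitive D" using IH by blast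
          then have "z \<^bold>\<in> D" using c(3) \<open>z \<^bold>\<in> x\<close> unfolding is_transitive_def subset_of_def by blast
          then show "z \<^bold>\<in> B" using B3 c by blast
        qed
        moreover have "subset_of A B" if "a \<^bold>\<in> b" "Lrel a A" for a A
          unfolding subset_of_def using B3 that by blast
        ultimately show ?thesis by blast
      qed
    qed
  qed
  then show "is_transitive B" "\<And>a A. a \<^bold>\<in> b \<Longrightarrow> Lrel a A \<Longrightarrow> subset_of A B"
    using assms by blast+
qed

lemma Lrel_trc: "Lrel a A \<Longrightarrow> trc {x. x \<^bold>\<in> A}"
  using Lrel_mono_trans(1)[of a A] unfolding trc_def is_transitive_def subset_of_def by blast

lemma trc_L: "trc L"
  unfolding trc_def
proof (intro ballI allI impI)
  fix x y assume "x \<in> L" "y \<^bold>\<in> x"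
  then obtain a A where A: "Lrel a A" "x \<^bold>\<in> A" unfolding L_iff by blast
  then have "y \<^bold>\<in> A" using Lrel_trc[OF A(1)] \<open>y \<^bold>\<in> x\<close> unfolding trc_def by blast
  with A(1) show "y \<in> L" unfolding L_iff by blast
qed

text \<open>Replacement sends each element to the index of the least level containing it; any
  ordinal above all of these indices will do, by monotonicity of the levels.\<close>

lemma L_bound:
  assumes "\<And>x. x \<^bold>\<in> X \<Longrightarrow> x \<in> L"
  shows "\<exists>a A. Lrel a A \<and> subset_of X A"
proof -
  define Q where "Q x a \<longleftrightarrow> (\<exists>A. Lrel a A \<and> x \<^bold>\<in> A)" for x a
  \<comment> \<open>Leastness makes the relation single-valued, as replacement demands.\<close>
  define Q' where "Q' x a \<longleftrightarrow> Q x a \<and> (\<forall>b. b \<^bold>\<in> a \<longrightarrow> \<not> Q x b)" for x a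
  have "\<exists>u. \<forall>a. a \<^bold>\<in> u \<longleftrightarrow> (\<exists>x. x \<^bold>\<in> X \<and> Q' x a)"
  proof (rule repl)
    show "defn UNIV UNIV (\<lambda>s. Q' (s 0) (s 1))"
      unfolding Q'_def Q_def by (intro defn_intros defn_Lrel)
    fix x a b assume "Q' x a" "Q' x b"
    then have "is_ordinal a" "is_ordinal b" "\<not> a \<^bold>\<in> b" "\<not> b \<^bold>\<in> a"
      unfolding Q'_def Q_def using Lrel_ordinal by blast+
    then show "a = b" using ordinal_linear by blast
  qed
  then obtain u where u: "\<And>a. a \<^bold>\<in> u \<longleftrightarrow> (\<exists>x. x \<^bold>\<in> X \<and> Q' x a)" by blast
  have "is_ordinal a" if "a \<^bold>\<in> u" for a
    using that u Lrel_ordinal unfolding Q'_def Q_def by blast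
  from ordinal_Union[OF this]
  obtain d where d: "is_ordinal d" "\<And>a. a \<^bold>\<in> u \<Longrightarrow> a \<^bold>\<in> d" by blast
  obtain D where D: "Lrel d D" using Lrel_ex[OF d(1)] by blast
  have "x \<^bold>\<in> D" if x: "x \<^bold>\<in> X" for x
  proof -
    obtain a where "Q x a" using assms[OF x] unfolding L_iff Q_def by blast
    moreover from this have "is_ordinal a" unfolding Q_def using Lrel_ordinal by blast
    moreover have "defn UNIV UNIV (\<lambda>s. Q x (s 0))"
      unfolding Q_def by (intro defn_intros defn_Lrel)
    ultimately obtain b where b: "Q' x b" using least_ordinal[of "Q x"] unfolding Q'_def by blast
    then have "b \<^bold>\<in> d" using u d(2) x by blast
    then show ?thesis
      using b Lrel_mono_trans(2)[OF D] unfolding Q'_def Q_def subset_of_def by blast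
  qed
  with D show ?thesis unfolding subset_of_def by blast
qed

lemma finite_set: "finite C \<Longrightarrow> \<exists>c. \<forall>x. x \<^bold>\<in> c \<longleftrightarrow> x \<in> C"
proof (induction C rule: finite_induct)
  case empty then show ?case by (intro exI[of _ emp]) simp
next
  case (insert a C)
  then obtain c where "\<forall>x. x \<^bold>\<in> c \<longleftrightarrow> x \<in> C" by blast
  then show ?case by (intro exI[of _ "un c (upair a a)"]) (auto simp: mem_un mem_upair)
qed

text \<open>\<open>Q\<close> is one fixed HOL predicate, while its formula may vary with
  \<open>N\<close>. Since \<open>X\<close> is already a set of the universe and \<open>C\<close> is
  finite, \<open>L_bound\<close> gives one level that contains both; then \<open>X\<close> belongs
  to the next level.\<close>

lemma L_comprehension:
  assumes Q: "\<And>N. trc N \<Longrightarrow> C \<subseteq> N \<Longrightarrow> defn N C (\<lambda>s. Q (s 0))"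
    and C: "finite C" "C \<subseteq> L"
    and X: "\<And>z. z \<^bold>\<in> X \<longleftrightarrow> z \<in> L \<and> Q z"
  shows "X \<in> L"
proof -
  obtain c where c: "\<And>x. x \<^bold>\<in> c \<longleftrightarrow> x \<in> C" using finite_set[OF C(1)] by blast
  have "x \<in> L" if "x \<^bold>\<in> un X c" for x using that c X C(2) mem_un by blast
  from L_bound[OF this] obtain a A where A: "Lrel a A" "subset_of (un X c) A" by blast
  have AL: "x \<in> L" if "x \<^bold>\<in> A" for x using A(1) that L_iff by blast
  have CA: "C \<subseteq> {x. x \<^bold>\<in> A}" using A(2) c unfolding subset_of_def mem_un by blast
  have XA: "x \<^bold>\<in> A" if "x \<^bold>\<in> X" for x using A(2) that unfolding subset_of_def mem_un by blast
  from Q[OF Lrel_trc[OF A(1)] CA] have "Def A X"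
    by (rule Def_comprehension[OF _ CA]) (use X XA AL in blast)
  moreover obtain B where "Lrel (suc a) B"
    using Lrel_ex[OF ordinal_suc[OF Lrel_ordinal[OF A(1)]]] by blast
  ultimately show ?thesis using Lrel_suc[OF _ A(1)] L_iff by blast
qed

section \<open>Closure of \<open>L\<close> under simple operations, and \<open>om\<close> in
  \<open>L\<close>\<close>

lemma upair_L: "a \<in> L \<Longrightarrow> b \<in> L \<Longrightarrow> upair a b \<in> L"
proof (rule L_comprehension)
  show "defn N {a, b} (\<lambda>s. s 0 = a \<or> s 0 = b)" for N by (intro defn_logic) simp_all
qed (auto simp: mem_upair)

lemma pr_L: "a \<in> L \<Longrightarrow> b \<in> L \<Longrightarrow> pr a b \<in> L"
  by (simp add: pr_def upair_L)

lemma un_L: "a \<in> L \<Longrightarrow> b \<in> L \<Longrightarrow> un a b \<in> L"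
proof (rule L_comprehension)
  show "defn N {a, b} (\<lambda>s. s 0 \<^bold>\<in> a \<or> s 0 \<^bold>\<in> b)" for N by (intro defn_logic) simp_all
qed (use trc_L in \<open>auto simp: mem_un trc_def\<close>)

lemma emp_L: "emp \<in> L"
  by (rule L_comprehension[of "{}" "\<lambda>_. False"]) (auto intro: defn_const)

lemma L_trans: "x \<in> L \<Longrightarrow> y \<^bold>\<in> x \<Longrightarrow> y \<in> L"
  using trc_L unfolding trc_def by blast

lemma L_eqI: "x \<in> L \<Longrightarrow> y \<in> L \<Longrightarrow> (\<And>z. z \<in> L \<Longrightarrow> z \<^bold>\<in> x \<longleftrightarrow> z \<^bold>\<in> y) \<Longrightarrow> x = y"
  using L_trans ext_iff by blast

text \<open>A bounded description of the natural numbers: ordinals that, like all their members, are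
  zero or successors. \<open>is_natural\<close> refers to all inductive sets and is not
  bounded.\<close>

definition nat_abs :: "'a \<Rightarrow> bool" where
  "nat_abs z \<longleftrightarrow> is_ordinal z \<and> (is_empty z \<or> (\<exists>y. y \<^bold>\<in> z \<and> is_succ y z)) \<and>
     (\<forall>x. x \<^bold>\<in> z \<longrightarrow> is_empty x \<or> (\<exists>y. y \<^bold>\<in> x \<and> is_succ y x))"

lemma defn_nat_abs: "trc N \<Longrightarrow> tm C t \<Longrightarrow> C \<subseteq> N \<Longrightarrow> defn N C (\<lambda>s. nat_abs (t s))"
  by (rule defn1[where Q = nat_abs]) (unfold nat_abs_def, intro defn_abs, simp_all)

text \<open>A least non-natural element of \<open>suc z\<close> would be a successor of a natural
  number.\<close>

lemma nat_abs_iff: "nat_abs z \<longleftrightarrow> z \<^bold>\<in> om"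
proof
  assume z: "nat_abs z"
  then have oz: "is_ordinal (suc z)" unfolding nat_abs_def using ordinal_suc by blast
  have pred: "is_empty x \<or> (\<exists>y. x = suc y)" if "x \<^bold>\<in> suc z" for x
    using z that unfolding nat_abs_def is_succ_iff mem_suc by blast
  show "z \<^bold>\<in> om"
  proof (rule ccontr)
    assume nz: "\<not> z \<^bold>\<in> om"
    have "\<exists>b. is_ordinal b \<and> (b \<^bold>\<in> suc z \<and> \<not> b \<^bold>\<in> om) \<and>
        (\<forall>c. c \<^bold>\<in> b \<longrightarrow> \<not> (c \<^bold>\<in> suc z \<and> \<not> c \<^bold>\<in> om))"
    proof (rule least_ordinal)
      show "defn UNIV UNIV (\<lambda>s. s 0 \<^bold>\<in> suc z \<and> \<not> s 0 \<^bold>\<in> om)" by (intro defn_intros)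
      show "is_ordinal z" using z unfolding nat_abs_def by blast
    qed (simp add: nz mem_suc)
    then obtain b where b: "b \<^bold>\<in> suc z" "\<not> b \<^bold>\<in> om"
      "\<And>c. c \<^bold>\<in> b \<Longrightarrow> c \<^bold>\<in> suc z \<Longrightarrow> c \<^bold>\<in> om" by blast
    have "b \<noteq> emp" using b(2) emp_om by blast
    then obtain y where y: "b = suc y" using pred[OF b(1)] unfolding is_empty_iff by blast
    then have "y \<^bold>\<in> om" using b(1,3) ordinal_trans[OF oz] mem_suc by blast
    then show False using b(2) y suc_om by blast
  qed
next
  have c: "is_empty x \<or> (\<exists>y. y \<^bold>\<in> x \<and> is_succ y x)" if "x \<^bold>\<in> om" for x
    using om_cases[OF that] unfolding is_empty_iff is_succ_iff by (auto simp: mem_suc)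
  assume "z \<^bold>\<in> om"
  then show "nat_abs z" unfolding nat_abs_def using c om_mem om_ordinal by blast
qed

lemma om_L: "om \<in> L"
proof -
  have "n \<in> L" if "n \<^bold>\<in> om" for n
  proof (rule om_induct[of "\<lambda>n. n \<in> L", OF _ that emp_L])
    show "defn UNIV UNIV (\<lambda>s. s 0 \<in> L)" by (intro defn_intros)
  qed (simp add: suc_def un_L upair_L)
  then have om: "z \<^bold>\<in> om \<longleftrightarrow> z \<in> L \<and> nat_abs z" for z unfolding nat_abs_iff by blast
  show ?thesis
    by (rule L_comprehension[where C = "{}", OF defn_nat_abs[OF _ tm_var] _ _ om]) simp_all
qed

section \<open>Removing the relativization to \<open>L\<close> from pairs and orders\<close>

lemma is_pair_L: "a \<in> L \<Longrightarrow> b \<in> L \<Longrightarrow> p \<in> L \<Longrightarrow> is_pair L a b p \<longleftrightarrow> p = pr a b"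
proof -
  have *: "is_upair L a b u \<longleftrightarrow> u = upair a b" if "a \<in> L" "b \<in> L" "u \<in> L" for a b u
    using L_eqI[OF that(3) upair_L[OF that(1,2)]] by (auto simp: is_upair_def mem_upair)
  assume "a \<in> L" "b \<in> L" "p \<in> L"
  then show ?thesis unfolding is_pair_def pr_def using upair_L by (auto simp: *)
qed

lemma related_L: "x \<in> L \<Longrightarrow> y \<in> L \<Longrightarrow> related L R x y \<longleftrightarrow> pr x y \<^bold>\<in> R"
  using pr_L is_pair_L unfolding related_def by blast

lemma partial_order_L_iff: "P \<in> L \<Longrightarrow> is_partial_order L P \<longleftrightarrow>
  (\<exists>A\<in>L. \<exists>R\<in>L. P = pr A R \<and> (\<exists>x. x \<^bold>\<in> A) \<and>
     (\<forall>p. p \<^bold>\<in> R \<longrightarrow> (\<exists>x y. x \<^bold>\<in> A \<and> y \<^bold>\<in> A \<and> p = pr x y)) \<and>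
     (\<forall>x. x \<^bold>\<in> A \<longrightarrow> pr x x \<^bold>\<in> R) \<and>
     (\<forall>x y. pr x y \<^bold>\<in> R \<and> pr y x \<^bold>\<in> R \<longrightarrow> x = y) \<and>
     (\<forall>x y z. pr x y \<^bold>\<in> R \<and> pr y z \<^bold>\<in> R \<longrightarrow> pr x z \<^bold>\<in> R))"
  (is "_ \<Longrightarrow> _ \<longleftrightarrow> (\<exists>A\<in>L. \<exists>R\<in>L. ?Q A R)")
proof -
  assume P: "P \<in> L"
  define Q where "Q A R \<longleftrightarrow> is_pair L A R P \<and>
        (\<exists>x\<in>L. x \<^bold>\<in> A) \<and>
        (\<forall>p\<in>L. p \<^bold>\<in> R \<longrightarrow> (\<exists>x\<in>L. \<exists>y\<in>L. x \<^bold>\<in> A \<and> y \<^bold>\<in> A \<and> is_pair L x y p)) \<and>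
        (\<forall>x\<in>L. x \<^bold>\<in> A \<longrightarrow> related L R x x) \<and>
        (\<forall>x\<in>L. \<forall>y\<in>L. related L R x y \<and> related L R y x \<longrightarrow> x = y) \<and>
        (\<forall>x\<in>L. \<forall>y\<in>L. \<forall>z\<in>L. related L R x y \<and> related L R y z \<longrightarrow> related L R x z)" for A R
  have "Q A R \<longleftrightarrow> ?Q A R" if A: "A \<in> L" and R: "R \<in> L" for A R
  proof -
    \<comment> \<open>The unordered pair of \<open>x\<close> and \<open>y\<close> is a member of
      \<open>pr x y\<close>, so transitivity of \<open>L\<close> reaches both components.\<close>
    have prL: "x \<in> L" "y \<in> L" if "pr x y \<^bold>\<in> R" for x y
    proof -
      have "upair x y \<in> L"
        using L_trans[OF L_trans[OF R that]] unfolding pr_def mem_upair by blast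
      then show "x \<in> L" "y \<in> L" using L_trans mem_upair by blast+
    qed
    have AL: "x \<in> L" if "x \<^bold>\<in> A" for x using L_trans[OF A that] .
    have RL: "x \<in> L" if "x \<^bold>\<in> R" for x using L_trans[OF R that] .
    have "(\<forall>p\<in>L. p \<^bold>\<in> R \<longrightarrow> (\<exists>x\<in>L. \<exists>y\<in>L. x \<^bold>\<in> A \<and> y \<^bold>\<in> A \<and> is_pair L x y p)) \<longleftrightarrow>
        (\<forall>p. p \<^bold>\<in> R \<longrightarrow> (\<exists>x y. x \<^bold>\<in> A \<and> y \<^bold>\<in> A \<and> p = pr x y))"
      using RL AL is_pair_L by (metis (no_types, lifting))
    moreover have "(\<forall>x\<in>L. x \<^bold>\<in> A \<longrightarrow> related L R x x) \<longleftrightarrow> (\<forall>x. x \<^bold>\<in> A \<longrightarrow> pr x x \<^bold>\<in> R)"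
      using AL related_L by blast
    moreover have "(\<forall>x\<in>L. \<forall>y\<in>L. related L R x y \<and> related L R y x \<longrightarrow> x = y) \<longleftrightarrow>
        (\<forall>x y. pr x y \<^bold>\<in> R \<and> pr y x \<^bold>\<in> R \<longrightarrow> x = y)"
      using prL related_L by blast
    moreover have "(\<forall>x\<in>L. \<forall>y\<in>L. \<forall>z\<in>L. related L R x y \<and> related L R y z \<longrightarrow> related L R x z) \<longleftrightarrow>
        (\<forall>x y z. pr x y \<^bold>\<in> R \<and> pr y z \<^bold>\<in> R \<longrightarrow> pr x z \<^bold>\<in> R)"
      using prL by (simp add: related_L) blast
    moreover have "(\<exists>x\<in>L. x \<^bold>\<in> A) \<longleftrightarrow> (\<exists>x. x \<^bold>\<in> A)" using AL by blast
    ultimately show ?thesis unfolding Q_def is_pair_L[OF A R P] by simp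
  qed
  then show ?thesis unfolding is_partial_order_def Q_def[symmetric]
    by (intro bex_cong refl)
qed

lemma is_countable_iff: "is_countable x \<longleftrightarrow> (\<exists>f. function_on f x \<and>
    (\<forall>a. a \<^bold>\<in> x \<longrightarrow> app f a \<^bold>\<in> om) \<and>
    (\<forall>a b. a \<^bold>\<in> x \<longrightarrow> b \<^bold>\<in> x \<longrightarrow> app f a = app f b \<longrightarrow> a = b))"
proof -
  have "maps_into f x om \<and> (\<forall>a b n. related UNIV f a n \<and> related UNIV f b n \<longrightarrow> a = b) \<longleftrightarrow>
      function_on f x \<and> (\<forall>a. a \<^bold>\<in> x \<longrightarrow> app f a \<^bold>\<in> om) \<and>
      (\<forall>a b. a \<^bold>\<in> x \<longrightarrow> b \<^bold>\<in> x \<longrightarrow> app f a = app f b \<longrightarrow> a = b)" for f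
  proof (cases "function_on f x")
    case True
    have "(\<forall>a y. related UNIV f a y \<longrightarrow> y \<^bold>\<in> om) \<longleftrightarrow> (\<forall>a. a \<^bold>\<in> x \<longrightarrow> app f a \<^bold>\<in> om)"
      unfolding related_iff mem_function[OF True] by simp
    moreover have "(\<forall>a b n. related UNIV f a n \<and> related UNIV f b n \<longrightarrow> a = b) \<longleftrightarrow>
      (\<forall>a b. a \<^bold>\<in> x \<longrightarrow> b \<^bold>\<in> x \<longrightarrow> app f a = app f b \<longrightarrow> a = b)"
      unfolding related_iff mem_function[OF True] by metis
    ultimately show ?thesis using True by (simp only: maps_into_def simp_thms)
  qed (simp add: maps_into_def)
  then show ?thesis unfolding is_countable_def is_omega_iff by simp
qed

lemma definable_inI:
  assumes "defn L {} (\<lambda>s. Q (s 0))" "x \<in> L" "\<And>v. v \<in> L \<Longrightarrow> Q v \<longleftrightarrow> v = x"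
  shows "definable_in L x"
proof -
  obtain p where fv: "fv p \<subseteq> {0}" and p: "\<And>v. v \<in> L \<Longrightarrow> sat L (\<lambda>_. v) p \<longleftrightarrow> v = x"
    using defn_closed_formula[OF assms(1)] assms(3) by blast
  then have "\<exists>!v. v \<in> L \<and> sat L (\<lambda>_. v) p"
    using assms(2) by (intro ex1I[of _ x]) auto
  moreover have "sat L (\<lambda>_. x) p" using p[OF assms(2)] by simp
  ultimately show ?thesis unfolding definable_in_def using fv assms(2) by blast
qed

lemma defn_is_partial_order: "defn L {} (\<lambda>s. is_partial_order L (s i))"
  unfolding is_partial_order_def is_pair_def related_def is_upair_def
  by (intro defn_ex_in defn_all_in defn_logic)

section \<open>From generic sets to countability\<close>

text \<open>
  For \<open>w = \<omega>\<close> the bound \<open>m\<close> makes the condition \<open>q\<close> finite; finiteness itself is never used, only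
  that \<open>m\<close> is a value not yet taken.
\<close>

definition pinj :: "'a \<Rightarrow> 'a \<Rightarrow> 'a \<Rightarrow> bool" where
  "pinj w x q \<longleftrightarrow>
     (\<exists>m. m \<^bold>\<in> w \<and> (\<forall>r. r \<^bold>\<in> q \<longrightarrow> (\<exists>y. y \<^bold>\<in> x \<and> (\<exists>n. n \<^bold>\<in> m \<and> is_pair UNIV y n r)))) \<and>
     (\<forall>y. y \<^bold>\<in> x \<longrightarrow> (\<forall>y'. y' \<^bold>\<in> x \<longrightarrow> (\<forall>n. n \<^bold>\<in> w \<longrightarrow> (\<forall>n'. n' \<^bold>\<in> w \<longrightarrow>
        related UNIV q y n \<longrightarrow> related UNIV q y' n' \<longrightarrow> (y = y' \<longleftrightarrow> n = n')))))"

lemma defn_pinj: "trc N \<Longrightarrow> tm C t \<Longrightarrow> tm C u \<Longrightarrow> tm C v \<Longrightarrow> C \<subseteq> N \<Longrightarrow>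
    defn N C (\<lambda>s. pinj (t s) (u s) (v s))"
  by (rule defn3[where Q = pinj]) (unfold pinj_def, intro defn_abs, simp_all)

lemma pinj_pair: "pinj om x q \<Longrightarrow> r \<^bold>\<in> q \<Longrightarrow> \<exists>y n. y \<^bold>\<in> x \<and> n \<^bold>\<in> om \<and> r = pr y n"
  unfolding pinj_def is_pair_iff using om_mem by blast

text \<open>The bounds in the second clause of \<open>pinj\<close> hold for all pairs in
  \<open>q\<close> by the first clause. The single equivalence says both that \<open>q\<close> is a
  function and that it is injective.\<close>

lemma pinj_inj:
  assumes q: "pinj om x q" and yn: "pr y n \<^bold>\<in> q" "pr y' n' \<^bold>\<in> q"
  shows "y = y' \<longleftrightarrow> n = n'"
proof -
  have "y \<^bold>\<in> x" "n \<^bold>\<in> om" "y' \<^bold>\<in> x" "n' \<^bold>\<in> om"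
    using pinj_pair[OF q yn(1)] pinj_pair[OF q yn(2)] unfolding pr_inject by blast+
  then show ?thesis using q yn unfolding pinj_def related_iff by blast
qed

text \<open>All values of \<open>q\<close> are members of its bound \<open>m\<close>, so
  \<open>m\<close> itself is a fresh value, and \<open>suc m\<close> bounds the extension.\<close>

lemma pinj_extend:
  assumes q: "pinj om x q" and y: "y \<^bold>\<in> x" and new: "\<And>n. \<not> pr y n \<^bold>\<in> q"
  shows "\<exists>n. n \<^bold>\<in> om \<and> pinj om x (un q (upair (pr y n) (pr y n)))"
proof -
  obtain m where m: "m \<^bold>\<in> om" "\<And>r. r \<^bold>\<in> q \<Longrightarrow> \<exists>y n. y \<^bold>\<in> x \<and> n \<^bold>\<in> m \<and> r = pr y n"
    using q unfolding pinj_def is_pair_iff by blast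
  let ?q = "un q (upair (pr y m) (pr y m))"
  have mem: "r \<^bold>\<in> ?q \<longleftrightarrow> r \<^bold>\<in> q \<or> r = pr y m" for r by (simp add: mem_un mem_upair)
  have fresh: "n \<noteq> m" if "pr z n \<^bold>\<in> q" for z n
    using m(2)[OF that] not_mem_self unfolding pr_inject by blast
  have bound: "\<exists>z. z \<^bold>\<in> x \<and> (\<exists>n. n \<^bold>\<in> suc m \<and> r = pr z n)" if "r \<^bold>\<in> ?q" for r
    using that m(2) y unfolding mem mem_suc by blast
  have "z = z' \<longleftrightarrow> n = n'" if "pr z n \<^bold>\<in> ?q" "pr z' n' \<^bold>\<in> ?q" for z z' n n'
    using that unfolding mem pr_inject
    by (elim disjE conjE) (use pinj_inj[OF q] fresh new in blast)+
  then have "pinj om x ?q"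
    unfolding pinj_def is_pair_iff related_iff using bound suc_om[OF m(1)] by blast
  then show ?thesis using m(1) by blast
qed

text \<open>Reverse inclusion on \<open>A\<close> as a bounded condition on pairs, with the stronger
  condition first, so that \<open>L_comprehension\<close> applies to the order.\<close>

definition extends_in :: "'a \<Rightarrow> 'a \<Rightarrow> bool" where
  "extends_in A z \<longleftrightarrow>
     (\<exists>p. p \<^bold>\<in> A \<and> (\<exists>q. q \<^bold>\<in> A \<and> is_pair UNIV p q z \<and> subset_of q p))"

lemma defn_extends_in: "trc N \<Longrightarrow> tm C t \<Longrightarrow> tm C u \<Longrightarrow> C \<subseteq> N \<Longrightarrow>
    defn N C (\<lambda>s. extends_in (t s) (u s))"
  by (rule defn2[where Q = extends_in]) (unfold extends_in_def, intro defn_abs, simp_all)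

lemma collapse_countable:
  assumes x: "x \<in> L"
    and A: "\<And>q. q \<^bold>\<in> A \<longleftrightarrow> q \<in> L \<and> pinj om x q" "A \<in> L"
    and R: "\<And>z. z \<^bold>\<in> R \<longleftrightarrow> extends_in A z"
    and G: "L_generic (pr A R) G"
  shows "is_countable x"
proof -
  have R2: "pr p q \<^bold>\<in> R \<longleftrightarrow> p \<^bold>\<in> A \<and> q \<^bold>\<in> A \<and> subset_of q p" for p q
    unfolding R extends_in_def is_pair_iff pr_inject by blast
  have filter: "is_filter A R G"
    and Gmeet: "\<And>D. D \<in> L \<Longrightarrow> is_dense A R D \<Longrightarrow> \<exists>q. q \<^bold>\<in> G \<and> q \<^bold>\<in> D"
    using G unfolding L_generic_def is_pair_iff pr_inject by auto
  have GA: "subset_of G A" using filter unfolding is_filter_def by blast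
  have Gdir: "\<exists>r. r \<^bold>\<in> G \<and> subset_of p r \<and> subset_of q r"
    if "p \<^bold>\<in> G" "q \<^bold>\<in> G" for p q
  proof -
    have "\<exists>r. r \<^bold>\<in> G \<and> related UNIV R r p \<and> related UNIV R r q"
      using filter that unfolding is_filter_def by blast
    then show ?thesis unfolding related_iff R2 by blast
  qed
  have Gpinj: "pinj om x q" if "q \<^bold>\<in> G" for q
    using GA that A(1) unfolding subset_of_def by blast
  \<comment> \<open>A common extension in the filter carries the equivalence across conditions; it
    makes the union of \<open>G\<close> single-valued and injective at once.\<close>
  have compat: "y = y' \<longleftrightarrow> n = n'"
    if q: "q \<^bold>\<in> G" "q' \<^bold>\<in> G" and yn: "pr y n \<^bold>\<in> q" "pr y' n' \<^bold>\<in> q'" for q q' y n y' n'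
  proof -
    obtain r where "r \<^bold>\<in> G" "subset_of q r" "subset_of q' r" using Gdir q by blast
    then show ?thesis using yn pinj_inj[OF Gpinj] unfolding subset_of_def by blast
  qed
  have total: "\<exists>q n. q \<^bold>\<in> G \<and> n \<^bold>\<in> om \<and> pr y n \<^bold>\<in> q" if y: "y \<^bold>\<in> x" for y
  proof -
    have "\<exists>D. \<forall>q. q \<^bold>\<in> D \<longleftrightarrow> q \<^bold>\<in> A \<and> (\<exists>n. n \<^bold>\<in> om \<and> related UNIV q y n)"
      by (rule sep) (intro defn_intros)
    then obtain D where D: "\<And>q. q \<^bold>\<in> D \<longleftrightarrow> q \<^bold>\<in> A \<and> (\<exists>n. n \<^bold>\<in> om \<and> related UNIV q y n)" by blast
    \<comment> \<open>Genericity concerns only constructible dense sets; \<open>D\<close> is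
      bounded-definable from \<open>A\<close>, \<open>om\<close> and \<open>y\<close>.\<close>
    have "D \<in> L"
    proof (rule L_comprehension)
      show "defn N {A, om, y} (\<lambda>s. s 0 \<^bold>\<in> A \<and> (\<exists>n. n \<^bold>\<in> om \<and> related UNIV (s 0) y n))"
        if "trc N" "{A, om, y} \<subseteq> N" for N
        by (intro defn_abs that) simp_all
      show "q \<^bold>\<in> D \<longleftrightarrow> q \<in> L \<and> (q \<^bold>\<in> A \<and> (\<exists>n. n \<^bold>\<in> om \<and> related UNIV q y n))" for q
        using D A(1) by blast
    qed (use A(2) om_L L_trans[OF x y] in auto)
    moreover have "\<exists>r. r \<^bold>\<in> D \<and> pr r q \<^bold>\<in> R" if q: "q \<^bold>\<in> A" for q
    proof (cases "\<exists>n. pr y n \<^bold>\<in> q")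
      case True
      then obtain n where n: "pr y n \<^bold>\<in> q" by blast
      have "n \<^bold>\<in> om" using pinj_pair[of x q "pr y n"] n q A(1) unfolding pr_inject by blast
      then have "q \<^bold>\<in> D" using D q n related_iff by blast
      then show ?thesis using R2 q unfolding subset_of_def by blast
    next
      case False
      then obtain n where n: "n \<^bold>\<in> om" "pinj om x (un q (upair (pr y n) (pr y n)))"
        using pinj_extend[of x q y] q A(1) y by blast
      let ?r = "un q (upair (pr y n) (pr y n))"
      have "q \<in> L" using q A(1) by blast
      then have "?r \<in> L" using L_trans[OF x y] L_trans[OF om_L n(1)] by (intro un_L upair_L pr_L)
      then have "?r \<^bold>\<in> A" using n(2) A(1) by blast
      moreover have "pr y n \<^bold>\<in> ?r" "subset_of q ?r" by (auto simp: mem_un mem_upair subset_of_def)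
      ultimately show ?thesis using D R2 q n(1) related_iff by blast
    qed
    then have "is_dense A R D"
      unfolding is_dense_def related_iff subset_of_def using D by blast
    ultimately obtain q where "q \<^bold>\<in> G" "q \<^bold>\<in> D" using Gmeet by blast
    then show ?thesis using D related_iff by blast
  qed
  have "\<exists>f. function_on f x \<and> (\<forall>y. y \<^bold>\<in> x \<longrightarrow> (\<exists>q. q \<^bold>\<in> G \<and> related UNIV q y (app f y)))"
  proof (rule function_ex)
    show "defn UNIV UNIV (\<lambda>s. \<exists>q. q \<^bold>\<in> G \<and> related UNIV q (s 0) (s 1))" by (intro defn_intros)
    fix y assume "y \<^bold>\<in> x"
    then obtain q n where "q \<^bold>\<in> G" "pr y n \<^bold>\<in> q" using total by blast
    then show "\<exists>!n. \<exists>q. q \<^bold>\<in> G \<and> related UNIV q y n"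
      unfolding related_iff using compat by (intro ex1I[of _ n]) blast+
  qed
  then obtain f where f: "function_on f x" "\<And>y. y \<^bold>\<in> x \<Longrightarrow> \<exists>q. q \<^bold>\<in> G \<and> pr y (app f y) \<^bold>\<in> q"
    unfolding related_iff by blast
  have "app f y \<^bold>\<in> om" if y: "y \<^bold>\<in> x" for y
  proof -
    obtain q where "q \<^bold>\<in> G" and q: "pr y (app f y) \<^bold>\<in> q" using f(2)[OF y] by blast
    from pinj_pair[OF Gpinj[OF this(1)] q] show ?thesis unfolding pr_inject by blast
  qed
  moreover have "a = b" if "a \<^bold>\<in> x" "b \<^bold>\<in> x" "app f a = app f b" for a b
    using f(2)[OF that(1)] f(2)[OF that(2)] compat that(3) by blast
  ultimately show ?thesis unfolding is_countable_iff using f(1) by blast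
qed

lemma IFS_L_countable:
  assumes IFS: "IFS_L" and def: "definable_in L x"
  shows "is_countable x"
proof -
  obtain p where x: "x \<in> L" and p: "\<And>v. v \<in> L \<Longrightarrow> sat L (\<lambda>_. v) p \<longleftrightarrow> v = x"
    using def unfolding definable_in_def by blast
  obtain T where T: "\<And>p. p \<^bold>\<in> T \<longleftrightarrow> (\<exists>a b. a \<^bold>\<in> x \<and> b \<^bold>\<in> om \<and> p = pr a b)"
    using times_ex by metis
  obtain PT where PT: "\<And>z. z \<^bold>\<in> PT \<longleftrightarrow> subset_of z T" using power_set by metis
  \<comment> \<open>The power set of the product is taken in the universe and only shows that the
    conditions form a set; membership of that set in \<open>L\<close> is a separate step.\<close>
  have "\<exists>A. \<forall>q. q \<^bold>\<in> A \<longleftrightarrow> q \<^bold>\<in> PT \<and> (q \<in> L \<and> pinj om x q)"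
    by (rule sep) (intro defn_intros defn_pinj)
  moreover have "q \<^bold>\<in> PT" if "pinj om x q" for q
    unfolding PT subset_of_def T using pinj_pair[OF that] by blast
  ultimately obtain A where A: "\<And>q. q \<^bold>\<in> A \<longleftrightarrow> q \<in> L \<and> pinj om x q" by blast
  have AL: "A \<in> L"
  proof (rule L_comprehension)
    show "defn N {om, x} (\<lambda>s. pinj om x (s 0))" if "trc N" "{om, x} \<subseteq> N" for N
      by (intro defn_pinj defn_abs that) simp_all
  qed (use A om_L x in auto)
  obtain T2 where T2: "\<And>p. p \<^bold>\<in> T2 \<longleftrightarrow> (\<exists>a b. a \<^bold>\<in> A \<and> b \<^bold>\<in> A \<and> p = pr a b)"
    using times_ex by metis
  have "\<exists>R. \<forall>z. z \<^bold>\<in> R \<longleftrightarrow> z \<^bold>\<in> T2 \<and> extends_in A z"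
    by (rule sep) (intro defn_intros defn_extends_in)
  then obtain R where R: "\<And>z. z \<^bold>\<in> R \<longleftrightarrow> extends_in A z"
    unfolding T2 extends_in_def is_pair_iff by blast
  have ext_L: "z \<in> L" if "extends_in A z" for z
    using that A pr_L unfolding extends_in_def is_pair_iff by blast
  have RL: "R \<in> L"
  proof (rule L_comprehension)
    show "defn N {A} (\<lambda>s. extends_in A (s 0))" if "trc N" "{A} \<subseteq> N" for N
      by (intro defn_extends_in defn_abs that) simp_all
  qed (use R ext_L AL in auto)
  \<comment> \<open>\<open>IFS_L\<close> allows no parameters, so \<open>x\<close>,
    \<open>om\<close>, \<open>A\<close> and \<open>R\<close> become quantified variables, each
    pinned down in \<open>L\<close>: the first by \<open>p\<close>, the others by their
    members.\<close>
  define \<psi> where "\<psi> P \<longleftrightarrow> (\<exists>u\<in>L. sat L (\<lambda>_. u) p \<and> (\<exists>w\<in>L. (\<forall>n\<in>L. n \<^bold>\<in> w \<longleftrightarrow> nat_abs n) \<and>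
    (\<exists>B\<in>L. (\<forall>q\<in>L. q \<^bold>\<in> B \<longleftrightarrow> pinj w u q) \<and>
    (\<exists>S\<in>L. (\<forall>z\<in>L. z \<^bold>\<in> S \<longleftrightarrow> extends_in B z) \<and> is_pair UNIV B S P))))" for P
  have "defn L {} (\<lambda>s. \<psi> (s 0))"
    unfolding \<psi>_def
    by (intro defn_ex_in defn_all_in defn_sat defn_nat_abs defn_pinj defn_extends_in defn_abs
        trc_L empty_subsetI)
  then obtain p' where p': "fv p' \<subseteq> {0}" "\<And>P. P \<in> L \<Longrightarrow> sat L (\<lambda>_. P) p' \<longleftrightarrow> \<psi> P"
    using defn_closed_formula by blast
  have \<psi>1: "P = pr A R" if "\<psi> P" for P
  proof -
    obtain w B S where w: "w \<in> L" "\<forall>n\<in>L. n \<^bold>\<in> w \<longleftrightarrow> nat_abs n"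
      and B: "B \<in> L" "\<forall>q\<in>L. q \<^bold>\<in> B \<longleftrightarrow> pinj w x q"
      and S: "S \<in> L" "\<forall>z\<in>L. z \<^bold>\<in> S \<longleftrightarrow> extends_in B z" and P: "P = pr B S"
      using \<open>\<psi> P\<close> p unfolding \<psi>_def is_pair_iff by blast
    have "w = om" using L_eqI[OF w(1) om_L] w(2) nat_abs_iff by blast
    then have "B = A" using L_eqI[OF B(1) AL] B(2) A by blast
    then have "S = R" using L_eqI[OF S(1) RL] S(2) R by blast
    with P \<open>B = A\<close> show ?thesis by simp
  qed
  have \<psi>2: "\<psi> (pr A R)"
    unfolding \<psi>_def is_pair_iff
    by (intro bexI[of _ x] bexI[of _ om] bexI[of _ A] bexI[of _ R] conjI)
       (use x om_L AL RL p A R nat_abs_iff in auto)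
  have R2: "pr q r \<^bold>\<in> R \<longleftrightarrow> q \<^bold>\<in> A \<and> r \<^bold>\<in> A \<and> subset_of r q" for q r
    unfolding R extends_in_def is_pair_iff pr_inject by blast
  \<comment> \<open>The empty condition keeps the order nonempty, even for empty
    \<open>x\<close>.\<close>
  have "pinj om x emp" unfolding pinj_def related_iff using emp_om by auto
  then have ne: "\<exists>q. q \<^bold>\<in> A" using A emp_L by blast
  have RA: "\<exists>q r. q \<^bold>\<in> A \<and> r \<^bold>\<in> A \<and> z = pr q r" if "z \<^bold>\<in> R" for z
    using that R unfolding extends_in_def is_pair_iff by blast
  have anti: "q = r" if "pr q r \<^bold>\<in> R \<and> pr r q \<^bold>\<in> R" for q r
    using that ext_iff[of q r] unfolding R2 subset_of_def by blast
  have po: "is_partial_order L (pr A R)"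
    unfolding partial_order_L_iff[OF pr_L[OF AL RL]]
    by (rule bexI[OF _ AL], rule bexI[OF _ RL], intro conjI refl ne allI impI)
       (use anti RA in \<open>auto simp: R2 subset_of_def\<close>)
  have unique: "\<exists>!P. P \<in> L \<and> is_partial_order L P \<and> sat L (\<lambda>_. P) p'"
    using p'(2) \<psi>1 \<psi>2 po pr_L[OF AL RL] by (intro ex1I[of _ "pr A R"]) blast+
  have "sat L (\<lambda>_. pr A R) p'" using p'(2) \<psi>2 pr_L[OF AL RL] by blast
  with po have "is_partial_order L (pr A R) \<and> sat L (\<lambda>_. pr A R) p'" ..
  from IFS[unfolded IFS_L_def, rule_format, OF p'(1) unique pr_L[OF AL RL] this]
  obtain G where "L_generic (pr A R) G" by blast
  then show ?thesis by (rule collapse_countable[OF x A AL R])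
qed

section \<open>From countability to generic sets\<close>

lemma defn_is_dense: "tm C t \<Longrightarrow> tm C u \<Longrightarrow> tm C v \<Longrightarrow>
    defn UNIV C (\<lambda>s. is_dense (t s) (u s) (v s))"
  by (rule defn3[where Q = is_dense]) (unfold is_dense_def, intro defn_intros, simp_all)

lemma Rasiowa_Sikorski:
  assumes ne: "a0 \<^bold>\<in> A"
    and reflR: "\<And>p. p \<^bold>\<in> A \<Longrightarrow> pr p p \<^bold>\<in> R"
    and transR: "\<And>p q r. pr p q \<^bold>\<in> R \<Longrightarrow> pr q r \<^bold>\<in> R \<Longrightarrow> pr p r \<^bold>\<in> R"
    and A: "is_countable A" and Y: "is_countable Y"
  shows "\<exists>G. is_filter A R G \<and>
    (\<forall>D. D \<^bold>\<in> Y \<longrightarrow> is_dense A R D \<longrightarrow> (\<exists>x. x \<^bold>\<in> G \<and> x \<^bold>\<in> D))"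
proof -
  obtain e where e: "function_on e A" "\<And>a. a \<^bold>\<in> A \<Longrightarrow> app e a \<^bold>\<in> om"
    "\<And>a b. a \<^bold>\<in> A \<Longrightarrow> b \<^bold>\<in> A \<Longrightarrow> app e a = app e b \<Longrightarrow> a = b"
    using A unfolding is_countable_iff by blast
  obtain f where f: "function_on f Y" "\<And>a. a \<^bold>\<in> Y \<Longrightarrow> app f a \<^bold>\<in> om"
    "\<And>a b. a \<^bold>\<in> Y \<Longrightarrow> b \<^bold>\<in> Y \<Longrightarrow> app f a = app f b \<Longrightarrow> a = b"
    using Y unfolding is_countable_iff by blast
  \<comment> \<open>Stage \<open>n\<close> asks for an element below all earlier ones and inside the
    dense member of \<open>Y\<close> that \<open>f\<close> codes by \<open>n\<close>, if there is
    one.\<close>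
  define cand where "cand n g y \<longleftrightarrow> y \<^bold>\<in> A \<and>
      (\<forall>k q. k \<^bold>\<in> n \<longrightarrow> related UNIV g k q \<longrightarrow> related UNIV R y q) \<and>
      (\<forall>D. D \<^bold>\<in> Y \<longrightarrow> is_dense A R D \<longrightarrow> related UNIV f D n \<longrightarrow> y \<^bold>\<in> D)" for n g y
  \<comment> \<open>\<open>cand\<close> has \<open>A\<close>, \<open>R\<close>, \<open>Y\<close> and
    \<open>f\<close> as hidden parameters, hence the condition that \<open>C\<close> is
    everything.\<close>
  have dcand: "defn UNIV C (\<lambda>s. cand (t s) (u s) (v s))"
    if "tm C t" "tm C u" "tm C v" "C = UNIV" for t u v C
  proof -
    have "defn UNIV UNIV (\<lambda>s. cand (s 0) (s 1) (s 2))"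
      unfolding cand_def by (intro defn_intros defn_is_dense)
    from defn_subst[OF this, of "\<lambda>i. if i = 0 then t else if i = 1 then u else v"]
    show ?thesis using that by simp
  qed
  \<comment> \<open>The candidate with least code under \<open>e\<close>; injectivity of
    \<open>e\<close> makes it unique, so the recursion step is single-valued.\<close>
  define best where "best n g y \<longleftrightarrow> cand n g y \<and>
      (\<forall>y'. cand n g y' \<longrightarrow> (\<exists>i j. related UNIV e y i \<and> related UNIV e y' j \<and> \<not> j \<^bold>\<in> i))" for n g y
  define \<Psi> where "\<Psi> g y \<longleftrightarrow>
      (\<exists>n. (\<forall>k. k \<^bold>\<in> n \<longleftrightarrow> (\<exists>q. related UNIV g k q)) \<and> best n g y)" for g y
  have "defn UNIV UNIV (\<lambda>s. \<Psi> (s 0) (s 1))"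
    unfolding \<Psi>_def best_def by (intro defn_intros dcand refl)
  from transfinite_recursion[OF this ordinal_om]
  obtain h where h: "function_on h om"
    and \<Psi>: "\<And>n g. n \<^bold>\<in> om \<Longrightarrow> is_restr h n g \<Longrightarrow> \<exists>!y. \<Psi> g y \<Longrightarrow> \<Psi> g (app h n)" by blast
  have candA: "y \<^bold>\<in> A" if "cand n g y" for n g y using that unfolding cand_def by blast
  have best_iff: "best n g y \<longleftrightarrow>
      cand n g y \<and> (\<forall>y'. cand n g y' \<longrightarrow> \<not> app e y' \<^bold>\<in> app e y)" for n g y
    unfolding best_def related_iff mem_function[OF e(1)] using candA by blast
  have best1: "\<exists>!y. best n g y" if c: "cand n g y" for n g y
  proof -
    have "\<exists>i. is_ordinal i \<and> (\<exists>y. cand n g y \<and> related UNIV e y i) \<and>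
        (\<forall>j. j \<^bold>\<in> i \<longrightarrow> \<not> (\<exists>y. cand n g y \<and> related UNIV e y j))"
    proof (rule least_ordinal)
      show "defn UNIV UNIV (\<lambda>s. \<exists>y. cand n g y \<and> related UNIV e y (s 0))"
        by (intro defn_intros dcand refl)
      show "is_ordinal (app e y)" using om_ordinal e(2) candA[OF c] by blast
      show "\<exists>z. cand n g z \<and> related UNIV e z (app e y)"
        unfolding related_iff mem_function[OF e(1)] using c candA by blast
    qed
    then obtain z where z: "cand n g z" "\<And>y. cand n g y \<Longrightarrow> \<not> app e y \<^bold>\<in> app e z"
      unfolding related_iff mem_function[OF e(1)] using candA by blast
    show ?thesis
    proof (rule ex1I[of _ z])
      show "best n g z" unfolding best_iff using z by blast
      fix y assume y: "best n g y"
      then have "\<not> app e y \<^bold>\<in> app e z" "\<not> app e z \<^bold>\<in> app e y" "y \<^bold>\<in> A" "z \<^bold>\<in> A"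
        using z candA unfolding best_iff by blast+
      then show "y = z" using ordinal_linear[OF om_ordinal om_ordinal] e(2,3) by blast
    qed
  qed
  \<comment> \<open>Since \<open>f\<close> is injective, at most one dense set has to be met at
    stage \<open>n\<close>; if none has this code, \<open>p\<close> itself works by
    reflexivity.\<close>
  have refine: "\<exists>y. y \<^bold>\<in> A \<and> pr y p \<^bold>\<in> R \<and>
      (\<forall>D. D \<^bold>\<in> Y \<longrightarrow> is_dense A R D \<longrightarrow> related UNIV f D n \<longrightarrow> y \<^bold>\<in> D)" if p: "p \<^bold>\<in> A" for p n
  proof (cases "\<exists>D. D \<^bold>\<in> Y \<and> is_dense A R D \<and> related UNIV f D n")
    case True
    then obtain D where D: "D \<^bold>\<in> Y" "is_dense A R D" "n = app f D"
      unfolding related_iff mem_function[OF f(1)] by blast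
    then obtain y where "y \<^bold>\<in> D" "pr y p \<^bold>\<in> R" "y \<^bold>\<in> A"
      using p unfolding is_dense_def related_iff subset_of_def by blast
    moreover have "D' = D" if "D' \<^bold>\<in> Y" "related UNIV f D' n" for D'
      using that D(1,3) f(3) unfolding related_iff mem_function[OF f(1)] by simp
    ultimately show ?thesis by blast
  qed (use reflR p in blast)
  \<comment> \<open>A lower bound \<open>p\<close> of the earlier values guarantees a candidate,
    hence the unique existence that the recursion theorem requires at this restriction.\<close>
  have step: "cand n h (app h n)"
    if n: "n \<^bold>\<in> om" and p: "p \<^bold>\<in> A" "\<And>k. k \<^bold>\<in> n \<Longrightarrow> pr p (app h k) \<^bold>\<in> R" for n p
  proof -
    obtain g where g: "is_restr h n g" using restr_ex by blast
    have dom: "k \<^bold>\<in> n \<longleftrightarrow> (\<exists>q. related UNIV g k q)" for k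
      unfolding related_iff mem_restr[OF g] mem_function[OF h] using om_mem[OF n] by blast
    have "m = n" if "\<forall>k. k \<^bold>\<in> m \<longleftrightarrow> (\<exists>q. related UNIV g k q)" for m
      using that unfolding ext_iff[of m] dom by blast
    then have \<Psi>g: "\<Psi> g y \<longleftrightarrow> best n g y" for y unfolding \<Psi>_def using dom by blast
    have cg: "cand n g y \<longleftrightarrow> cand n h y" for y
      unfolding cand_def related_iff mem_restr[OF g] by blast
    obtain y where y: "y \<^bold>\<in> A" "pr y p \<^bold>\<in> R"
      "\<forall>D. D \<^bold>\<in> Y \<longrightarrow> is_dense A R D \<longrightarrow> related UNIV f D n \<longrightarrow> y \<^bold>\<in> D" using refine[OF p(1)] by blast
    have "pr y q \<^bold>\<in> R" if "k \<^bold>\<in> n" "pr k q \<^bold>\<in> h" for k q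
      using transR[OF y(2) p(2)[OF that(1)]] that(2) mem_function[OF h] by simp
    with y have "cand n h y" unfolding cand_def related_iff by blast
    then have "\<exists>!y. \<Psi> g y" unfolding \<Psi>g using best1 cg by blast
    from \<Psi>[OF n g this] show ?thesis unfolding \<Psi>g best_iff cg by blast
  qed
  \<comment> \<open>The lower bound needed for \<open>step\<close> is \<open>a0\<close> at zero and
    the preceding value \<open>app h n\<close> at \<open>suc n\<close>.\<close>
  have cand_h: "cand n h (app h n)" if "n \<^bold>\<in> om" for n
  proof -
    have "\<forall>y. related UNIV h n y \<longrightarrow> cand n h y"
    proof (rule om_induct[of "\<lambda>n. \<forall>y. related UNIV h n y \<longrightarrow> cand n h y", OF _ that])
      show "defn UNIV UNIV (\<lambda>s. \<forall>y. related UNIV h (s 0) y \<longrightarrow> cand (s 0) h y)"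
        by (intro defn_intros dcand refl)
      show "\<forall>y. related UNIV h emp y \<longrightarrow> cand emp h y"
        unfolding related_iff mem_function[OF h] using step[OF emp_om ne] by simp
    next
      fix n assume n: "n \<^bold>\<in> om" and IH: "\<forall>y. related UNIV h n y \<longrightarrow> cand n h y"
      then have c: "cand n h (app h n)" unfolding related_iff mem_function[OF h] by blast
      have "pr (app h n) (app h k) \<^bold>\<in> R" if k: "k \<^bold>\<in> suc n" for k
      proof (cases "k = n")
        case True then show ?thesis using reflR candA[OF c] by simp
      next
        case False
        then have "k \<^bold>\<in> n" using k mem_suc by blast
        then show ?thesis
          using c om_mem[OF n] unfolding cand_def related_iff mem_function[OF h] by blast
      qed
      then have "cand (suc n) h (app h (suc n))" using step[OF suc_om[OF n] candA[OF c]] by blast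
      then show "\<forall>y. related UNIV h (suc n) y \<longrightarrow> cand (suc n) h y"
        unfolding related_iff mem_function[OF h] by simp
    qed
    then show ?thesis unfolding related_iff mem_function[OF h] using that by simp
  qed
  have hA: "app h n \<^bold>\<in> A" if "n \<^bold>\<in> om" for n using candA[OF cand_h[OF that]] .
  have desc: "pr (app h n) (app h k) \<^bold>\<in> R" if "n \<^bold>\<in> om" "k \<^bold>\<in> n" for n k
    using cand_h[OF that(1)] that om_mem unfolding cand_def related_iff mem_function[OF h] by blast
  \<comment> \<open>The upward closure of the descending sequence.\<close>
  have "\<exists>G. \<forall>q. q \<^bold>\<in> G \<longleftrightarrow>
      q \<^bold>\<in> A \<and> (\<exists>n. n \<^bold>\<in> om \<and> (\<exists>p. related UNIV h n p \<and> related UNIV R p q))"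
    by (rule sep) (intro defn_intros)
  then obtain G where G: "\<And>q. q \<^bold>\<in> G \<longleftrightarrow>
      q \<^bold>\<in> A \<and> (\<exists>n. n \<^bold>\<in> om \<and> pr (app h n) q \<^bold>\<in> R)"
    unfolding related_iff mem_function[OF h] by blast
  have hG: "app h n \<^bold>\<in> G" if "n \<^bold>\<in> om" for n using G hA that reflR by blast
  have "is_filter A R G"
    unfolding is_filter_def related_iff
  proof (intro conjI allI impI)
    show "subset_of G A" using G unfolding subset_of_def by blast
    show "\<not> is_empty G" using hG emp_om unfolding is_empty_def by blast
    show "y \<^bold>\<in> G" if "x \<^bold>\<in> G \<and> y \<^bold>\<in> A \<and> pr x y \<^bold>\<in> R" for x y using that G transR by blast
    show "\<exists>z. z \<^bold>\<in> G \<and> pr z x \<^bold>\<in> R \<and> pr z y \<^bold>\<in> R" if xy: "x \<^bold>\<in> G \<and> y \<^bold>\<in> G" for x y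
    proof -
      obtain m n where m: "m \<^bold>\<in> om" "pr (app h m) x \<^bold>\<in> R" and n: "n \<^bold>\<in> om" "pr (app h n) y \<^bold>\<in> R"
        using xy G by blast
      from ordinal_linear[OF om_ordinal[OF m(1)] om_ordinal[OF n(1)]]
      consider "m \<^bold>\<in> n" | "m = n" | "n \<^bold>\<in> m" by blast
      then show ?thesis
      proof cases
        case 1 then show ?thesis using desc[OF n(1)] transR m(2) n(2) hG[OF n(1)] by blast
      next
        case 2 then show ?thesis using m(2) n(2) hG[OF n(1)] by blast
      next
        case 3 then show ?thesis using desc[OF m(1)] transR m(2) n(2) hG[OF m(1)] by blast
      qed
    qed
  qed
  moreover have "\<exists>x. x \<^bold>\<in> G \<and> x \<^bold>\<in> D" if D: "D \<^bold>\<in> Y" "is_dense A R D" for D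
  proof -
    have "related UNIV f D (app f D)" unfolding related_iff mem_function[OF f(1)] using D by blast
    then have "app h (app f D) \<^bold>\<in> D" using cand_h[OF f(2)[OF D(1)]] D unfolding cand_def by blast
    then show ?thesis using hG f(2)[OF D(1)] by blast
  qed
  ultimately show ?thesis by blast
qed

lemma countable_IFS_L:
  assumes cnt: "\<And>x. definable_in L x \<Longrightarrow> is_countable x"
  shows "IFS_L"
  unfolding IFS_L_def
proof (intro allI impI ballI)
  fix p P
  assume ex1: "\<exists>!P. P \<in> L \<and> is_partial_order L P \<and> sat L (\<lambda>_. P) p"
    and PL: "P \<in> L" and P: "is_partial_order L P \<and> sat L (\<lambda>_. P) p"
  have uniq: "P' = P" if "P' \<in> L" "is_partial_order L P'" "sat L (\<lambda>_. P') p" for P'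
    using ex1 PL P that by blast
  from P[THEN conjunct1, unfolded partial_order_L_iff[OF PL]]
  obtain A R where A: "A \<in> L" and R: "R \<in> L" and PAR: "P = pr A R" and ne: "\<exists>x. x \<^bold>\<in> A"
    and reflR: "\<forall>x. x \<^bold>\<in> A \<longrightarrow> pr x x \<^bold>\<in> R"
    and transR: "\<forall>x y z. pr x y \<^bold>\<in> R \<and> pr y z \<^bold>\<in> R \<longrightarrow> pr x z \<^bold>\<in> R" by blast
  obtain PA where PA: "\<And>z. z \<^bold>\<in> PA \<longleftrightarrow> subset_of z A" using power_set by metis
  have "\<exists>Y. \<forall>D. D \<^bold>\<in> Y \<longleftrightarrow> D \<^bold>\<in> PA \<and> D \<in> L"
    by (rule sep) (intro defn_intros)
  then obtain Y where Y: "\<And>D. D \<^bold>\<in> Y \<longleftrightarrow> D \<in> L \<and> subset_of D A" unfolding PA by blast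
  have YL: "Y \<in> L"
  proof (rule L_comprehension)
    show "defn N {A} (\<lambda>s. subset_of (s 0) A)" if "trc N" "{A} \<subseteq> N" for N
      by (intro defn_abs that) simp_all
  qed (use Y A in auto)
  \<comment> \<open>\<open>p\<close> singles out the order \<open>P\<close>; its domain is recovered
    as the first component, again with no parameters.\<close>
  define \<alpha> where "\<alpha> B \<longleftrightarrow> (\<exists>P\<in>L. is_partial_order L P \<and> sat L (\<lambda>_. P) p \<and>
      (\<exists>S\<in>L. is_pair UNIV B S P))" for B
  have \<alpha>: "\<alpha> B \<longleftrightarrow> B = A" for B
  proof
    assume "\<alpha> B"
    then obtain S where "pr B S = P" using uniq unfolding \<alpha>_def is_pair_iff by blast
    then show "B = A" unfolding PAR pr_inject by blast
  qed (use P PL PAR R in \<open>auto simp: \<alpha>_def is_pair_iff\<close>)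
  have d\<alpha>: "defn L {} (\<lambda>s. \<alpha> (s 0))"
    unfolding \<alpha>_def
    by (intro defn_ex_in defn_is_partial_order defn_sat defn_abs trc_L empty_subsetI)
  have "definable_in L A" using definable_inI[OF d\<alpha> A \<alpha>] .
  moreover have "definable_in L Y"
  proof (rule definable_inI[OF _ YL])
    show "defn L {} (\<lambda>s. \<exists>B\<in>L. \<alpha> B \<and> (\<forall>D\<in>L. D \<^bold>\<in> s 0 \<longleftrightarrow> subset_of D B))"
      by (intro defn_ex_in defn_all_in defn1[OF d\<alpha>] defn_abs trc_L empty_subsetI)
    fix v assume v: "v \<in> L"
    have "(\<forall>D\<in>L. D \<^bold>\<in> v \<longleftrightarrow> subset_of D A) \<longleftrightarrow> v = Y"
      using L_eqI[OF v YL] Y by blast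
    then show "(\<exists>B\<in>L. \<alpha> B \<and> (\<forall>D\<in>L. D \<^bold>\<in> v \<longleftrightarrow> subset_of D B)) \<longleftrightarrow> v = Y"
      unfolding \<alpha> using A by blast
  qed
  ultimately obtain G where G: "is_filter A R G"
    "\<And>D. D \<^bold>\<in> Y \<Longrightarrow> is_dense A R D \<Longrightarrow> \<exists>x. x \<^bold>\<in> G \<and> x \<^bold>\<in> D"
    using Rasiowa_Sikorski[of _ A R Y] ne reflR transR cnt by metis
  \<comment> \<open>Density includes being a subset of \<open>A\<close>, so every constructible
    dense set is a member of \<open>Y\<close>.\<close>
  have "\<exists>x. x \<^bold>\<in> G \<and> x \<^bold>\<in> D" if "D \<in> L" "is_dense A R D" for D
    using G(2) that Y unfolding is_dense_def by blast
  then have "L_generic P G" unfolding L_generic_def is_pair_iff PAR using G(1) by blast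
  then show "\<exists>G. L_generic P G" ..
qed

end

theorem theorem11:
  fixes mem :: "'a \<Rightarrow> 'a \<Rightarrow> bool"
  assumes "ZFC mem"
  shows "set_structure.IFS_L mem \<longleftrightarrow>
    (\<forall>x. set_structure.definable_in mem (set_structure.L mem) x \<longrightarrow>
       set_structure.is_countable mem x)"
proof -
  interpret ZFC mem by (rule assms)
  show ?thesis using IFS_L_countable countable_IFS_L by blast
qed

end
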